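(* Let $E$ be a $2$-concave symmetric Banach sequence space (with $\|e_n\|_E=1$ for all $n$). Then the identity map $\mathrm{id}: E \hookrightarrow \ell_2$ is $(E,1)$-summing. In other words, for every unconditionally summable sequence $(x_n)$ in $E$ the scalar sequence $(\|x_n\|_{\ell_2})_n$ is contained in $E$.
   Context: A Banach sequence space is a real Banach space $E$ of real sequences (indexed by $\mathbb{N}$) which contains some $x$ with $x_n\neq 0$ for all $n$ and such that $y\in E$, $|x_n|\le |y_n|$ for all $n$ imply $x\in E$ and $\|x\|_E\le\|y\|_E$. $E$ is symmetric if $\|(x_n)\|_E=\|(x_n^* )\|_E$, where $(x_n^* )$ is the decreasing rearrangement $x_n^*=\inf\{\sup_{i\in\mathbb{N}\setminus J}|x_i| : J\subset\mathbb{N},\ \mathrm{card}(J)<n\}$. $E$ is $2$-concave if there is $C>0$ such that $(\sum_{i=1}^n\|x_i\|_E^2)^{1/2}\le C\,\|(\sum_{i=1}^n|x_i|^2)^{1/2}\|_E$ for all finite families $x_1,\dots,x_n\in E$. $(e_n)$ denotes the standard unit vectors. $E\hookrightarrow F$ means that $E$ is contained in $F$ with continuous identity map; a $2$-concave symmetric Banach sequence space satisfies $E\hookrightarrow\ell_2$. Let $1\le p<\infty$ and let $E$ be a Banach sequence space with $\ell_p\hookrightarrow E$ and $\|e_n\|_E=1$ for all $n$; put $c_p^E:=\|\mathrm{id}:\ell_p\hookrightarrow E\|$. An operator (bounded linear map) $T:X\to Y$ between Banach spaces is $(E,p)$-summing if there is $C>0$ such that for all $n$ and $x_1,\dots,x_n\in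 X$ $$\Big\|\sum_{i=1}^n\|Tx_i\|_Y\,e_i\Big\|_E\le C\cdot c_p^E\cdot\sup_{x'\in B_{X'}}\Big(\sum_{i=1}^n|\langle x',x_i\rangle|^p\Big)^{1/p}.$$ (For $p=1$ one always has $\ell_1\hookrightarrow E$ with $c_1^E=1$.) A sequence $(x_n)$ in a Banach space is unconditionally summable if $\sum_n x_n$ converges unconditionally. *)

theory Defs
  imports "HOL-Analysis.Analysis" "HOL-Library.Function_Algebras"
begin

text \<open>Sequences form a real vector space under the pointwise operations.\<close>

instantiation "fun" :: (type, real_vector) real_vector
begin

definition "c *\<^sub>R f = (\<lambda>x. c *\<^sub>R f x)"

instance
  by standard (simp_all add: scaleR_fun_def fun_eq_iff scaleR_add_right scaleR_add_left)

end

lemma scaleR_fun_apply [simp]: "(c *\<^sub>R f) x = c *\<^sub>R f x"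
  by (simp add: scaleR_fun_def)


text \<open>
  A normed space is a subspace \<open>X\<close> of an ambient real vector space together with a function
  \<open>nrm\<close> whose values matter only on \<open>X\<close>.
\<close>

locale normed_space_on =
  fixes X :: "'a::real_vector set" and nrm :: "'a \<Rightarrow> real"
  assumes subspace_X: "subspace X"
    and norm_eq_0: "x \<in> X \<Longrightarrow> nrm x = 0 \<longleftrightarrow> x = 0"
    and norm_triangle: "x \<in> X \<Longrightarrow> y \<in> X \<Longrightarrow> nrm (x + y) \<le> nrm x + nrm y"
    and norm_scaleR: "x \<in> X \<Longrightarrow> nrm (c *\<^sub>R x) = \<bar>c\<bar> * nrm x"

locale banach_space_on = normed_space_on +
  assumes complete_X:
    "\<lbrakk>\<And>n. s n \<in> X; \<And>e. e > 0 \<Longrightarrow> \<exists>M. \<forall>m\<ge>M. \<forall>n\<ge>M. nrm (s m - s n) < e\<rbrakk>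
      \<Longrightarrow> \<exists>l\<in>X. (\<lambda>n. nrm (s n - l)) \<longlonglongrightarrow> 0"

definition bounded_linear_on ::
  "'a::real_vector set \<Rightarrow> ('a \<Rightarrow> real) \<Rightarrow> 'b::real_vector set \<Rightarrow> ('b \<Rightarrow> real) \<Rightarrow> ('a \<Rightarrow> 'b) \<Rightarrow> bool" where
  "bounded_linear_on X normX Y normY T \<longleftrightarrow>
     (\<forall>x\<in>X. T x \<in> Y) \<and>
     (\<forall>x\<in>X. \<forall>y\<in>X. T (x + y) = T x + T y) \<and>
     (\<forall>c. \<forall>x\<in>X. T (c *\<^sub>R x) = c *\<^sub>R T x) \<and>
     (\<exists>C. \<forall>x\<in>X. normY (T x) \<le> C * normX x)"

definition onorm_on ::
  "'a set \<Rightarrow> ('a \<Rightarrow> real) \<Rightarrow> ('b \<Rightarrow> real) \<Rightarrow> ('a \<Rightarrow> 'b) \<Rightarrow> real" where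
  "onorm_on X normX normY T = (SUP x\<in>{x\<in>X. normX x \<le> 1}. normY (T x))"

definition continuously_embedded ::
  "'a::real_vector set \<Rightarrow> ('a \<Rightarrow> real) \<Rightarrow> 'a set \<Rightarrow> ('a \<Rightarrow> real) \<Rightarrow> bool" where
  "continuously_embedded X normX Y normY \<longleftrightarrow> bounded_linear_on X normX Y normY id"

definition dual_unit_ball :: "'a::real_vector set \<Rightarrow> ('a \<Rightarrow> real) \<Rightarrow> ('a \<Rightarrow> real) set" where
  "dual_unit_ball X normX =
     {f. bounded_linear_on X normX (UNIV :: real set) abs f \<and> onorm_on X normX abs f \<le> 1}"


text \<open>Sequences are indexed from 0 throughout.\<close>

definition unit_vec :: "nat \<Rightarrow> nat \<Rightarrow> real" where
  "unit_vec n = (\<lambda>k. if k = n then 1 else 0)"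

locale banach_sequence_space = banach_space_on E normE
  for E :: "(nat \<Rightarrow> real) set" and normE :: "(nat \<Rightarrow> real) \<Rightarrow> real" +
  assumes full_support: "\<exists>x\<in>E. \<forall>n. x n \<noteq> 0"
    and solid: "y \<in> E \<Longrightarrow> (\<And>n. \<bar>x n\<bar> \<le> \<bar>y n\<bar>) \<Longrightarrow> x \<in> E \<and> normE x \<le> normE y"

text \<open>
  With indices starting at 0, the condition that \<open>J\<close> has fewer than \<open>n\<close> elements becomes
  \<open>card J \<le> n\<close>.  The supremum is a real one, so the definition is meaningful for bounded
  sequences only.
\<close>

definition decreasing_rearrangement :: "(nat \<Rightarrow> real) \<Rightarrow> nat \<Rightarrow> real" where
  "decreasing_rearrangement x n = (INF J\<in>{J. finite J \<and> card J \<le> n}. SUP i\<in>-J. \<bar>x i\<bar>)"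

text \<open>
  Boundedness of \<open>x\<close> says that its decreasing rearrangement is real-valued
  (for unbounded \<open>x\<close> all its entries are infinite).
\<close>

definition symmetric_space :: "(nat \<Rightarrow> real) set \<Rightarrow> ((nat \<Rightarrow> real) \<Rightarrow> real) \<Rightarrow> bool" where
  "symmetric_space E normE \<longleftrightarrow>
     (\<forall>x\<in>E. bounded (range x) \<and> decreasing_rearrangement x \<in> E \<and>
            normE x = normE (decreasing_rearrangement x))"

definition two_concave :: "(nat \<Rightarrow> real) set \<Rightarrow> ((nat \<Rightarrow> real) \<Rightarrow> real) \<Rightarrow> bool" where
  "two_concave E normE \<longleftrightarrow>
     (\<exists>C>0. \<forall>n. \<forall>x :: nat \<Rightarrow> nat \<Rightarrow> real. (\<forall>i<n. x i \<in> E) \<longrightarrow>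
        sqrt (\<Sum>i<n. (normE (x i))\<^sup>2) \<le> C * normE (\<lambda>k. sqrt (\<Sum>i<n. \<bar>x i k\<bar>\<^sup>2)))"

definition lp_space :: "real \<Rightarrow> (nat \<Rightarrow> real) set" where
  "lp_space p = {x. summable (\<lambda>n. \<bar>x n\<bar> powr p)}"

definition lp_norm :: "real \<Rightarrow> (nat \<Rightarrow> real) \<Rightarrow> real" where
  "lp_norm p x = (\<Sum>n. \<bar>x n\<bar> powr p) powr (1 / p)"

text \<open>
  \<open>(E,p)\<close>-summing operators, for \<open>1 \<le> p < \<infinity>\<close>.  The notion presupposes that \<open>\<ell>\<^sub>p\<close> is continuously
  embedded in \<open>E\<close>; the norm of this embedding enters as the factor \<open>onorm_on \<dots> id\<close>.
\<close>

definition summing_operator ::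
  "(nat \<Rightarrow> real) set \<Rightarrow> ((nat \<Rightarrow> real) \<Rightarrow> real) \<Rightarrow> real \<Rightarrow>
   'a::real_vector set \<Rightarrow> ('a \<Rightarrow> real) \<Rightarrow> 'b::real_vector set \<Rightarrow> ('b \<Rightarrow> real) \<Rightarrow> ('a \<Rightarrow> 'b) \<Rightarrow> bool" where
  "summing_operator E normE p X normX Y normY T \<longleftrightarrow>
     continuously_embedded (lp_space p) (lp_norm p) E normE \<and>
     bounded_linear_on X normX Y normY T \<and>
     (\<exists>C>0. \<forall>n. \<forall>x :: nat \<Rightarrow> 'a. (\<forall>i<n. x i \<in> X) \<longrightarrow>
        normE (\<Sum>i<n. normY (T (x i)) *\<^sub>R unit_vec i)
          \<le> C * onorm_on (lp_space p) (lp_norm p) normE id *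
             (SUP f\<in>dual_unit_ball X normX. (\<Sum>i<n. \<bar>f (x i)\<bar> powr p) powr (1 / p)))"

definition unconditionally_summable ::
  "'a::real_vector set \<Rightarrow> ('a \<Rightarrow> real) \<Rightarrow> (nat \<Rightarrow> 'a) \<Rightarrow> bool" where
  "unconditionally_summable X normX x \<longleftrightarrow>
     (\<forall>n. x n \<in> X) \<and>
     (\<forall>\<pi>. bij \<pi> \<longrightarrow> (\<exists>s\<in>X. (\<lambda>m. normX ((\<Sum>i<m. x (\<pi> i)) - s)) \<longlonglongrightarrow> 0))"

end

theory Submission
  imports Defs "HOL-Combinatorics.Permutations"
begin

text \<open>
  Let \<open>x = (x i k)\<close> be a finite matrix with \<open>\<Sum>i. \<bar>\<Sum>k. b k * x i k\<bar> \<le> 1\<close> for all \<open>b\<close> in the dual unit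
  ball of \<open>E\<close>.  Khinchine's inequality, applied to the signs of the columns and of the rows, bounds
  \<open>\<Sum>i. sqrt (\<Sum>k. (b k)\<^sup>2 * (x i k)\<^sup>2)\<close> and \<open>\<Sum>k. \<bar>b k\<bar> * c k\<close>, where \<open>c k\<close> is the Euclidean norm of
  the \<open>k\<close>-th column.  By \<open>2\<close>-concavity the squares \<open>b\<^sup>2\<close> may be replaced by points of their convex
  hull, and a Maurey-type argument turns both bounds into weights.  Together these give summable
  \<open>\<mu>\<close> and a \<open>\<nu>\<close> with \<open>\<Sum>k. (b k)\<^sup>2 * \<nu> k\<close> bounded on the dual ball such that
  \<open>(x i k)\<^sup>2 = \<mu> i * t i k * \<nu> k\<close> with \<open>t\<close> doubly substochastic.  As the dual ball is invariant under
  permutations, \<open>\<Sum>i. (b i)\<^sup>2 * (\<Sum>k. t i k * \<nu> k)\<close> is bounded as well, and the Cauchy-Schwarz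
  inequality bounds \<open>\<Sum>i. b i * r i\<close> for the Euclidean norms \<open>r i\<close> of the rows.
\<close>

section \<open>Khinchine's inequality\<close>

lemma sum_Pow_lessThan_Suc:
  fixes f :: "nat set \<Rightarrow> 'a::comm_monoid_add"
  shows "(\<Sum>S\<in>Pow {..<Suc n}. f S) = (\<Sum>S\<in>Pow {..<n}. f S + f (insert n S))"
proof -
  have "inj_on (insert n) (Pow {..<n})"
    by (rule inj_onI) (blast dest: insert_ident[THEN iffD1, rotated 2])
  moreover have "Pow {..<n} \<inter> insert n ` Pow {..<n} = {}"
    by auto
  ultimately show ?thesis
    by (simp add: lessThan_Suc Pow_insert sum.union_disjoint sum.reindex sum.distrib)
qed

text \<open>A Rademacher sum: \<open>S\<close> is the set of indices with sign \<open>+1\<close>, so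
  that averages over all choices of sign become sums over \<open>Pow {..<n}\<close> divided by
  \<open>2 ^ n\<close>.\<close>

definition signed_sum :: "(nat \<Rightarrow> real) \<Rightarrow> nat \<Rightarrow> nat set \<Rightarrow> real" where
  "signed_sum y n S = (\<Sum>k<n. (if k \<in> S then 1 else - 1) * y k)"

lemma signed_sum_Suc:
  assumes "S \<subseteq> {..<n}"
  shows "signed_sum y (Suc n) S = signed_sum y n S - y n"
    and "signed_sum y (Suc n) (insert n S) = signed_sum y n S + y n"
proof -
  have n: "n \<notin> S" using assms by auto
  show "signed_sum y (Suc n) S = signed_sum y n S - y n"
    using n by (simp add: signed_sum_def)
  have "(\<Sum>k<n. (if k \<in> insert n S then 1 else - 1) * y k) =
        (\<Sum>k<n. (if k \<in> S then 1 else - 1) * y k)"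
    by (rule sum.cong) auto
  then show "signed_sum y (Suc n) (insert n S) = signed_sum y n S + y n"
    by (simp add: signed_sum_def)
qed

lemma signed_sum_second_moment:
  "(\<Sum>S\<in>Pow {..<n}. (signed_sum y n S)\<^sup>2) = 2 ^ n * (\<Sum>k<n. (y k)\<^sup>2)"
proof (induction n)
  case 0
  then show ?case by (simp add: signed_sum_def)
next
  case (Suc n)
  have "(\<Sum>S\<in>Pow {..<Suc n}. (signed_sum y (Suc n) S)\<^sup>2) =
        (\<Sum>S\<in>Pow {..<n}. 2 * (signed_sum y n S)\<^sup>2 + 2 * (y n)\<^sup>2)"
    unfolding sum_Pow_lessThan_Suc
    by (rule sum.cong) (auto simp: signed_sum_Suc power2_eq_square algebra_simps)
  also have "\<dots> = 2 * (2 ^ n * (\<Sum>k<n. (y k)\<^sup>2)) + 2 ^ n * (2 * (y n)\<^sup>2)"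
    by (simp add: sum.distrib flip: sum_distrib_left Suc.IH) (simp add: card_Pow)
  finally show ?case by (simp add: algebra_simps)
qed

lemma signed_sum_fourth_moment:
  "(\<Sum>S\<in>Pow {..<n}. (signed_sum y n S) ^ 4) \<le> 3 * 2 ^ n * (\<Sum>k<n. (y k)\<^sup>2)\<^sup>2"
proof (induction n)
  case 0
  then show ?case by (simp add: signed_sum_def)
next
  case (Suc n)
  let ?q = "\<Sum>k<n. (y k)\<^sup>2"
  have "(\<Sum>S\<in>Pow {..<Suc n}. (signed_sum y (Suc n) S) ^ 4) =
        (\<Sum>S\<in>Pow {..<n}. 2 * (signed_sum y n S) ^ 4 + 12 * (y n)\<^sup>2 * (signed_sum y n S)\<^sup>2 + 2 * (y n) ^ 4)"
    unfolding sum_Pow_lessThan_Suc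
    by (rule sum.cong) (auto simp: signed_sum_Suc power2_eq_square power4_eq_xxxx algebra_simps)
  also have "\<dots> = 2 * (\<Sum>S\<in>Pow {..<n}. (signed_sum y n S) ^ 4) + 12 * (y n)\<^sup>2 * (2 ^ n * ?q) + 2 ^ n * (2 * (y n) ^ 4)"
    by (simp add: sum.distrib flip: sum_distrib_left signed_sum_second_moment) (simp add: card_Pow)
  \<comment> \<open>Enlarging the coefficient of \<open>(y n) ^ 4\<close> from \<open>2\<close> to
    \<open>6\<close> completes the square \<open>(?q + (y n)^2)^2\<close>.\<close>
  also have "\<dots> \<le> 2 * (3 * 2 ^ n * ?q\<^sup>2) + 12 * (y n)\<^sup>2 * (2 ^ n * ?q) + 2 ^ n * (6 * (y n) ^ 4)"
    using Suc.IH by (intro add_mono mult_left_mono) auto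
  also have "\<dots> = 3 * 2 ^ Suc n * (\<Sum>k<Suc n. (y k)\<^sup>2)\<^sup>2"
    by (simp add: power2_eq_square power4_eq_xxxx algebra_simps)
  finally show ?case .
qed

text \<open>The mean absolute value is controlled from below by the second and fourth moments: a
  polynomial inequality valid at every point is summed over all choices of sign.\<close>

lemma khinchine:
  "2 ^ n * sqrt (\<Sum>k<n. (y k)\<^sup>2) \<le> sqrt 3 * (\<Sum>S\<in>Pow {..<n}. \<bar>signed_sum y n S\<bar>)"
proof (cases "(\<Sum>k<n. (y k)\<^sup>2) = 0")
  case True
  then show ?thesis by (simp add: sum_nonneg)
next
  case False
  define s where "s = sqrt (\<Sum>k<n. (y k)\<^sup>2)"
  have s2: "s\<^sup>2 = (\<Sum>k<n. (y k)\<^sup>2)" by (simp add: s_def sum_nonneg)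
  have s: "s > 0" using False unfolding s_def
    by (metis less_eq_real_def real_sqrt_gt_zero sum_nonneg zero_le_power2)
  \<comment> \<open>Among the multiples of \<open>s\<close>, this one gives the best constant when
    \<open>pt\<close> is combined with the two moment estimates.\<close>
  define a where "a = sqrt 3 * s"
  have a: "a > 0" "a\<^sup>2 = 3 * s\<^sup>2" using s by (auto simp: a_def power_mult_distrib)
  \<comment> \<open>\<open>u\<^sup>3 - 3u + 2 = (u - 1)\<^sup>2 (u + 2) \<ge> 0\<close> with \<open>u = \<bar>x\<bar> / a\<close>\<close>
  have pt: "3 * a\<^sup>2 * x\<^sup>2 - x ^ 4 \<le> 2 * a ^ 3 * \<bar>x\<bar>" for x :: real
  proof -
    have "0 \<le> \<bar>x\<bar> * ((\<bar>x\<bar> - a)\<^sup>2 * (\<bar>x\<bar> + 2 * a))" using a by simp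
    also have "\<dots> = \<bar>x\<bar> ^ 4 - 3 * a\<^sup>2 * \<bar>x\<bar>\<^sup>2 + 2 * a ^ 3 * \<bar>x\<bar>"
      by (simp add: power2_eq_square power3_eq_cube power4_eq_xxxx algebra_simps)
    finally show ?thesis by (simp add: power_even_abs)
  qed
  let ?f = "signed_sum y n"
  have "3 * a\<^sup>2 * (2 ^ n * s\<^sup>2) - 3 * 2 ^ n * (s\<^sup>2)\<^sup>2
      \<le> 3 * a\<^sup>2 * (\<Sum>S\<in>Pow {..<n}. (?f S)\<^sup>2) - (\<Sum>S\<in>Pow {..<n}. (?f S) ^ 4)"
    using signed_sum_fourth_moment[of y n] by (simp add: signed_sum_second_moment s2)
  also have "\<dots> = (\<Sum>S\<in>Pow {..<n}. 3 * a\<^sup>2 * (?f S)\<^sup>2 - (?f S) ^ 4)"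
    by (simp add: sum_subtractf sum_distrib_left)
  also have "\<dots> \<le> (\<Sum>S\<in>Pow {..<n}. 2 * a ^ 3 * \<bar>?f S\<bar>)"
    by (intro sum_mono pt)
  also have "\<dots> = 2 * s ^ 3 * 3 * (sqrt 3 * (\<Sum>S\<in>Pow {..<n}. \<bar>?f S\<bar>))"
    by (simp add: a_def power_mult_distrib power3_eq_cube flip: sum_distrib_left)
  finally have "(6 * s ^ 3) * (2 ^ n * s) \<le> (6 * s ^ 3) * (sqrt 3 * (\<Sum>S\<in>Pow {..<n}. \<bar>?f S\<bar>))"
    unfolding a(2) by (simp add: power2_eq_square power3_eq_cube algebra_simps)
  then have "2 ^ n * s \<le> sqrt 3 * (\<Sum>S\<in>Pow {..<n}. \<bar>?f S\<bar>)"
    using s by (subst (asm) mult_le_cancel_left_pos) auto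
  then show ?thesis by (simp add: s_def)
qed

text \<open>All rows use the same signs, so Khinchine's inequality for the single rows can be added
  up and the bound \<open>W\<close> averaged over the signs.\<close>

lemma sum_row_norms_le:
  fixes y :: "'i \<Rightarrow> nat \<Rightarrow> real"
  assumes "\<And>\<epsilon>. (\<And>k. \<epsilon> k = 1 \<or> \<epsilon> k = - 1) \<Longrightarrow> (\<Sum>i\<in>I. \<bar>\<Sum>k<n. \<epsilon> k * y i k\<bar>) \<le> W"
  shows "(\<Sum>i\<in>I. sqrt (\<Sum>k<n. (y i k)\<^sup>2)) \<le> sqrt 3 * W"
proof -
  have "2 ^ n * (\<Sum>i\<in>I. sqrt (\<Sum>k<n. (y i k)\<^sup>2))
      \<le> (\<Sum>i\<in>I. sqrt 3 * (\<Sum>S\<in>Pow {..<n}. \<bar>signed_sum (y i) n S\<bar>))"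
    unfolding sum_distrib_left[of "2 ^ n"] by (intro sum_mono khinchine)
  also have "\<dots> = sqrt 3 * (\<Sum>S\<in>Pow {..<n}. \<Sum>i\<in>I. \<bar>signed_sum (y i) n S\<bar>)"
    by (subst sum.swap) (simp add: sum_distrib_left)
  also have "\<dots> \<le> sqrt 3 * (\<Sum>S\<in>Pow {..<n}. W)"
    unfolding signed_sum_def by (intro mult_left_mono sum_mono assms) auto
  also have "\<dots> = 2 ^ n * (sqrt 3 * W)" by (simp add: card_Pow)
  finally show ?thesis by simp
qed

section \<open>Weights from a convex set\<close>

text \<open>With \<open>u = sqrt (x + h)\<close> and \<open>v = sqrt x\<close>, the error of the
  linear approximation is exactly \<open>(u - v)^2 / (2 * v)\<close>, and
  \<open>v * |u - v| \<le> |h|\<close> because \<open>v \<le> u + v\<close>.\<close>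

lemma sqrt_add_ge:
  fixes x h :: real
  assumes "x > 0" "x + h \<ge> 0"
  shows "sqrt x + h / (2 * sqrt x) - h\<^sup>2 / (2 * x * sqrt x) \<le> sqrt (x + h)"
proof -
  define u v where "u = sqrt (x + h)" and "v = sqrt x"
  have uv: "u \<ge> 0" "v > 0" "x = v\<^sup>2" "h = u\<^sup>2 - v\<^sup>2"
    using assms by (auto simp: u_def v_def)
  have "v\<^sup>2 \<le> (u + v)\<^sup>2" using uv by (intro power_mono) auto
  then have "(u - v)\<^sup>2 * v\<^sup>2 \<le> (u - v)\<^sup>2 * (u + v)\<^sup>2" by (intro mult_left_mono) auto
  also have "\<dots> = h\<^sup>2" unfolding uv(4) by (simp add: power2_eq_square algebra_simps)
  finally have 1: "(u - v)\<^sup>2 * v\<^sup>2 \<le> h\<^sup>2" .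
  have "v + h / (2 * v) - u = (u - v)\<^sup>2 * v\<^sup>2 / (2 * v\<^sup>2 * v)"
    using uv(2) unfolding uv(4) by (simp add: field_simps power2_eq_square)
  also have "\<dots> \<le> h\<^sup>2 / (2 * v\<^sup>2 * v)" using 1 uv(2) by (intro divide_right_mono) auto
  finally show ?thesis using uv(3) unfolding u_def[symmetric] v_def[symmetric] by simp
qed

text \<open>
  The weights are \<open>sqrt (\<delta> + A i z)\<close> for an almost maximal point \<open>z\<close> of the concave function
  \<open>\<Sum>i<n. sqrt (\<delta> + A i z)\<close>; the second estimate is the first-order condition at \<open>z\<close>.
\<close>

lemma convex_weights:
  fixes A :: "nat \<Rightarrow> 'a::real_vector \<Rightarrow> real"
  assumes D: "convex D" "D \<noteq> {}" and lin: "\<And>i. linear (A i)"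
    and nonneg: "\<And>i z. i < n \<Longrightarrow> z \<in> D \<Longrightarrow> 0 \<le> A i z"
    and W: "W > 0" "\<And>z. z \<in> D \<Longrightarrow> (\<Sum>i<n. sqrt (A i z)) \<le> W"
  obtains m where "\<And>i. m i > 0" "(\<Sum>i<n. m i) \<le> 2 * W"
    "\<And>z. z \<in> D \<Longrightarrow> (\<Sum>i<n. A i z / m i) \<le> 2 * W"
proof -
  \<comment> \<open>The shift keeps the square roots away from \<open>0\<close>, where they are not
    differentiable; its size lets all \<open>n\<close> shifts together cost at most
    \<open>W / 2\<close>.\<close>
  define d where "d = (W / (2 * (real n + 1)))\<^sup>2"
  have d: "d > 0" using W(1) by (simp add: d_def)
  have "sqrt d = W / (2 * (real n + 1))" using W(1) by (simp add: d_def)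
  then have "real n * sqrt d + sqrt d = W / 2" by (simp add: field_simps)
  then have sqd: "real n * sqrt d \<le> W / 2" using d by (smt (verit) real_sqrt_ge_zero)
  define S where "S z = (\<Sum>i<n. sqrt (d + A i z))" for z
  have S_le: "S z \<le> W + W / 2" if "z \<in> D" for z
  proof -
    have "S z \<le> (\<Sum>i<n. sqrt d + sqrt (A i z))" unfolding S_def
      by (intro sum_mono) (use d nonneg that in \<open>auto intro!: sqrt_add_le_add_sqrt\<close>)
    also have "\<dots> \<le> W / 2 + W" using W(2)[OF that] sqd by (simp add: sum.distrib)
    finally show ?thesis by simp
  qed
  have A_le: "A i z \<le> W\<^sup>2" if "i < n" "z \<in> D" for i z
  proof -
    have "sqrt (A i z) \<le> (\<Sum>i<n. sqrt (A i z))"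
      using that nonneg by (intro member_le_sum) auto
    then have "sqrt (A i z) \<le> W" using W(2)[OF that(2)] by linarith
    then show ?thesis by (rule sqrt_le_D)
  qed
  \<comment> \<open>\<open>t^2 * L\<close> bounds the sum of the second-order errors of
    \<open>S\<close> when \<open>z\<close> is moved by the fraction \<open>t\<close> towards another
    point of \<open>D\<close>.\<close>
  define L where "L = real n * ((W\<^sup>2)\<^sup>2 / (2 * d * sqrt d))"
  have L: "L \<ge> 0" using d by (simp add: L_def)
  define t where "t = min 1 (W / (4 * (1 + L)))"
  have t: "0 < t" "t \<le> 1" using W(1) L by (auto simp: t_def)
  have "t \<le> W / (4 * (1 + L))" by (simp add: t_def)
  then have tL: "2 * t * (1 + L) \<le> W / 2" using L by (simp add: field_simps)
  have bdd: "bdd_above (S ` D)" using S_le by (rule bdd_aboveI2)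
  \<comment> \<open>The supremum need not be attained. A defect of \<open>t^2\<close> has the order
    of the Taylor error, and after division by \<open>t / 2\<close> both together cost
    \<open>2 * t * (1 + L) \<le> W / 2\<close>.\<close>
  have "Sup (S ` D) - t\<^sup>2 < Sup (S ` D)" using t by simp
  then obtain z where z: "z \<in> D" "Sup (S ` D) - t\<^sup>2 < S z"
    using less_cSup_iff[of "S ` D"] D(2) bdd by auto
  define m where "m i = (if i < n then sqrt (d + A i z) else 1)" for i
  have m_pos: "m i > 0" for i using d nonneg[OF _ z(1)] by (simp add: m_def add_pos_nonneg)
  have m_sum: "(\<Sum>i<n. m i) = S z" by (simp add: S_def m_def)
  have m_le: "S z \<le> 2 * W" using S_le[OF z(1)] W(1) by simp
  have "(\<Sum>i<n. A i x / m i) \<le> 2 * W" if x: "x \<in> D" for x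
  proof -
    define y where "y = (1 - t) *\<^sub>R z + t *\<^sub>R x"
    have y: "y \<in> D" using D(1) z(1) x t unfolding y_def by (intro convexD) auto
    define h where "h i = A i x - A i z" for i
    have Ay: "A i y = A i z + t * h i" for i
      by (simp add: y_def h_def linear_add[OF lin] linear_scale[OF lin] left_diff_distrib right_diff_distrib)
    have h_le: "(h i)\<^sup>2 \<le> (W\<^sup>2)\<^sup>2" if "i < n" for i
    proof -
      have "\<bar>h i\<bar> \<le> W\<^sup>2"
        using A_le[OF that x] A_le[OF that z(1)] nonneg[OF that x] nonneg[OF that z(1)]
        by (simp add: h_def abs_le_iff)
      then show ?thesis by (metis abs_ge_zero power2_abs power_mono)
    qed
    have "S z + t * (\<Sum>i<n. h i / m i) / 2 - t\<^sup>2 * L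
        \<le> (\<Sum>i<n. m i + t * h i / (2 * m i) - t\<^sup>2 * ((W\<^sup>2)\<^sup>2 / (2 * d * sqrt d)))"
      by (simp add: sum.distrib sum_subtractf m_sum L_def sum_distrib_left sum_divide_distrib mult_ac)
    also have "\<dots> \<le> (\<Sum>i<n. sqrt (d + A i y))"
    proof (rule sum_mono)
      fix i assume "i \<in> {..<n}"
      then have i: "i < n" by simp
      have dA: "d + A i z \<ge> d" using nonneg[OF i z(1)] by simp
      have mi: "m i = sqrt (d + A i z)" using i by (simp add: m_def)
      have "(t * h i)\<^sup>2 / (2 * (d + A i z) * sqrt (d + A i z)) \<le> t\<^sup>2 * (W\<^sup>2)\<^sup>2 / (2 * d * sqrt d)"
        unfolding power_mult_distrib
        using d dA h_le[OF i] by (intro frac_le mult_mono real_sqrt_le_mono mult_left_mono) auto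
      moreover have "sqrt (d + A i z) + t * h i / (2 * sqrt (d + A i z))
          - (t * h i)\<^sup>2 / (2 * (d + A i z) * sqrt (d + A i z)) \<le> sqrt (d + A i z + t * h i)"
        using d dA nonneg[OF i y] Ay[of i] by (intro sqrt_add_ge) auto
      ultimately show "m i + t * h i / (2 * m i) - t\<^sup>2 * ((W\<^sup>2)\<^sup>2 / (2 * d * sqrt d)) \<le> sqrt (d + A i y)"
        unfolding mi Ay by (simp add: add.assoc)
    qed
    also have "\<dots> = S y" by (simp add: S_def)
    also have "\<dots> \<le> Sup (S ` D)" using bdd y by (intro cSup_upper) auto
    finally have "t * (\<Sum>i<n. h i / m i) / 2 \<le> t\<^sup>2 * (1 + L)" using z(2) by (simp add: algebra_simps)
    then have "t * ((\<Sum>i<n. h i / m i)) \<le> t * (2 * t * (1 + L))" by (simp add: power2_eq_square algebra_simps)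
    then have 1: "(\<Sum>i<n. h i / m i) \<le> 2 * t * (1 + L)" using t by (subst (asm) mult_le_cancel_left_pos)
    have "(\<Sum>i<n. A i z / m i) \<le> (\<Sum>i<n. m i)"
    proof (rule sum_mono)
      fix i assume "i \<in> {..<n}"
      then have i: "i < n" by simp
      have "A i z \<le> m i * m i" using d nonneg[OF i z(1)] i by (simp add: m_def)
      then show "A i z / m i \<le> m i" using m_pos[of i] by (simp add: field_simps)
    qed
    then have "(\<Sum>i<n. A i x / m i) \<le> S z + 2 * t * (1 + L)"
      using 1 by (simp add: h_def diff_divide_distrib sum_subtractf m_sum)
    then show ?thesis using S_le[OF z(1)] tL W(1) by simp
  qed
  then show ?thesis using that[of m] m_pos m_sum m_le by auto
qed

section \<open>Doubly substochastic matrices\<close>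

text \<open>Abel summation as an induction: since the partial sums of \<open>d\<close> are
  nonnegative, replacing all weights by the last and smallest one can only decrease the sum.\<close>

lemma sum_mult_antimono_nonneg:
  fixes B d :: "nat \<Rightarrow> real"
  assumes "\<And>i. Suc i < n \<Longrightarrow> B (Suc i) \<le> B i" "\<And>i. i < n \<Longrightarrow> 0 \<le> B i"
    and "\<And>m. m \<le> n \<Longrightarrow> 0 \<le> (\<Sum>i<m. d i)"
  shows "0 \<le> (\<Sum>i<n. B i * d i)"
proof (cases n)
  case (Suc n')
  have "m < n \<Longrightarrow> B m * (\<Sum>i<Suc m. d i) \<le> (\<Sum>i<Suc m. B i * d i)" for m
  proof (induction m)
    case (Suc m)
    have "B (Suc m) * (\<Sum>i<Suc m. d i) \<le> B m * (\<Sum>i<Suc m. d i)"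
      using assms(1)[of m] assms(3)[of "Suc m"] Suc.prems by (intro mult_right_mono) auto
    also have "\<dots> \<le> (\<Sum>i<Suc m. B i * d i)" using Suc by simp
    finally show ?case by (simp add: algebra_simps)
  qed simp
  from this[of n'] show ?thesis using assms(2)[of n'] assms(3)[of n] Suc
    by (smt (verit) lessI mult_nonneg_nonneg order_refl)
qed simp

lemma sum_mult_antimono_mono:
  fixes B g h :: "nat \<Rightarrow> real"
  assumes "\<And>i. Suc i < n \<Longrightarrow> B (Suc i) \<le> B i" "\<And>i. i < n \<Longrightarrow> 0 \<le> B i"
    and "\<And>m. m \<le> n \<Longrightarrow> (\<Sum>i<m. g i) \<le> (\<Sum>i<m. h i)"
  shows "(\<Sum>i<n. B i * g i) \<le> (\<Sum>i<n. B i * h i)"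
  using sum_mult_antimono_nonneg[of n B "\<lambda>i. h i - g i"] assms
  by (simp add: sum_subtractf right_diff_distrib)

definition doubly_substochastic :: "nat \<Rightarrow> (nat \<Rightarrow> nat \<Rightarrow> real) \<Rightarrow> bool" where
  "doubly_substochastic n t \<longleftrightarrow> (\<forall>i<n. \<forall>k<n. 0 \<le> t i k) \<and>
     (\<forall>i<n. (\<Sum>k<n. t i k) \<le> 1) \<and> (\<forall>k<n. (\<Sum>i<n. t i k) \<le> 1)"

text \<open>Abel summation is applied once for each of the two sorted sequences. What remains is the
  sum of the entries of \<open>t\<close> in the first \<open>m\<close> rows and \<open>l\<close>
  columns, which is at most \<open>min l m\<close>.\<close>

lemma doubly_substochastic_sorted_le:
  assumes t: "doubly_substochastic n t"
    and B: "\<And>i. Suc i < n \<Longrightarrow> B (Suc i) \<le> B i" "\<And>i. i < n \<Longrightarrow> 0 \<le> B i"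
    and v: "\<And>i. Suc i < n \<Longrightarrow> v (Suc i) \<le> v i" "\<And>i. i < n \<Longrightarrow> 0 \<le> v i"
  shows "(\<Sum>i<n. B i * (\<Sum>k<n. t i k * v k)) \<le> (\<Sum>i<n. B i * v i)"
proof (rule sum_mult_antimono_mono)
  fix m assume m: "m \<le> n"
  have "(\<Sum>i<m. \<Sum>k<n. t i k * v k) = (\<Sum>k<n. v k * (\<Sum>i<m. t i k))"
    by (subst sum.swap) (simp add: sum_distrib_left mult.commute)
  also have "\<dots> \<le> (\<Sum>k<n. v k * (if k < m then 1 else 0))"
  proof (rule sum_mult_antimono_mono)
    fix l assume l: "l \<le> n"
    have nn: "\<And>i k. i < n \<Longrightarrow> k < n \<Longrightarrow> 0 \<le> t i k" using t by (simp add: doubly_substochastic_def)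
    have "(\<Sum>k<l. \<Sum>i<m. t i k) \<le> (\<Sum>k<l. 1)"
    proof (rule sum_mono)
      fix k assume "k \<in> {..<l}"
      then have k: "k < n" using l by simp
      have "(\<Sum>i<m. t i k) \<le> (\<Sum>i<n. t i k)" using m nn k by (intro sum_mono2) auto
      also have "\<dots> \<le> 1" using t k by (simp add: doubly_substochastic_def)
      finally show "(\<Sum>i<m. t i k) \<le> 1" .
    qed
    moreover have "(\<Sum>k<l. \<Sum>i<m. t i k) \<le> (\<Sum>i<m. 1)"
    proof (subst sum.swap, rule sum_mono)
      fix i assume "i \<in> {..<m}"
      then have i: "i < n" using m by simp
      have "(\<Sum>k<l. t i k) \<le> (\<Sum>k<n. t i k)" using l nn i by (intro sum_mono2) auto
      also have "\<dots> \<le> 1" using t i by (simp add: doubly_substochastic_def)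
      finally show "(\<Sum>k<l. t i k) \<le> 1" .
    qed
    moreover have "(\<Sum>k<l. if k < m then 1 else 0) = real (min l m)"
    proof -
      have "{..<l} \<inter> {k. k < m} = {..<min l m}" by auto
      then show ?thesis by (simp add: sum.If_cases)
    qed
    ultimately show "(\<Sum>k<l. \<Sum>i<m. t i k) \<le> (\<Sum>k<l. if k < m then 1 else 0)"
      by (simp add: min_def)
  qed (use v in auto)
  also have "\<dots> = (\<Sum>i<m. v i)"
  proof -
    have "{..<n} \<inter> {k. k < m} = {..<m}" using m by auto
    then show ?thesis by (simp add: if_distrib sum.If_cases cong: if_cong)
  qed
  finally show "(\<Sum>i<m. \<Sum>k<n. t i k * v k) \<le> (\<Sum>i<m. v i)" .
qed (use B in auto)

lemma ex_sorting_permutation: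
  fixes f :: "nat \<Rightarrow> real"
  obtains p where "p permutes {..<n}" "\<And>i. Suc i < n \<Longrightarrow> f (p (Suc i)) \<le> f (p i)"
proof -
  define xs where "xs = map f [0..<n]"
  define ys where "ys = rev (sort xs)"
  have "mset ys = mset xs" by (simp add: ys_def)
  then obtain p where p: "p permutes {..<length xs}" "permute_list p xs = ys"
    by (rule mset_eq_permutation)
  have len: "length xs = n" "length ys = n" by (auto simp: xs_def ys_def)
  have ysi: "ys ! i = f (p i)" if "i < n" for i
  proof -
    have "p i < n" using p(1) that len permutes_in_image[of p "{..<n}" i] by auto
    then show ?thesis using p that len by (auto simp: permute_list_nth xs_def simp flip: p(2))
  qed
  have "sorted_wrt (\<ge>) ys" by (simp add: ys_def sorted_wrt_rev)
  then have "f (p (Suc i)) \<le> f (p i)" if "Suc i < n" for i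
    using that ysi[of i] ysi[of "Suc i"] len
    by (metis Suc_lessD lessI sorted_wrt_nth_less)
  then show ?thesis using that p(1) len by auto
qed

text \<open>Permutation matrices are extremal for such bilinear forms. Rows and columns of
  \<open>t\<close> are permuted so that \<open>B\<close> and \<open>v\<close> become sorted; the
  sorted case then bounds the form by the sum that belongs to
  \<open>p \<circ> inv q\<close>.\<close>

lemma doubly_substochastic_bilinear_le:
  assumes t: "doubly_substochastic n t"
    and B: "\<And>i. 0 \<le> B i" and v: "\<And>i. 0 \<le> v i"
    and M: "\<And>p. p permutes {..<n} \<Longrightarrow> (\<Sum>i<n. B (p i) * v i) \<le> M"
  shows "(\<Sum>i<n. B i * (\<Sum>k<n. t i k * v k)) \<le> M"
proof -
  obtain p where p: "p permutes {..<n}" "\<And>i. Suc i < n \<Longrightarrow> B (p (Suc i)) \<le> B (p i)"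
    using ex_sorting_permutation[of n B] by blast
  obtain q where q: "q permutes {..<n}" "\<And>i. Suc i < n \<Longrightarrow> v (q (Suc i)) \<le> v (q i)"
    using ex_sorting_permutation[of n v] by blast
  have pn: "p i < n" "q i < n" if "i < n" for i
    using p(1) q(1) that permutes_in_image[of _ "{..<n}" i] by auto
  have reix: "(\<Sum>i<n. f (r i)) = (\<Sum>i<n. f i)" if "r permutes {..<n}" for f :: "nat \<Rightarrow> real" and r
    using sum.permute[OF that, of f] by (simp add: o_def)
  have "doubly_substochastic n (\<lambda>i k. t (p i) (q k))"
    using t pn reix[OF p(1), of "\<lambda>i. t i _"] reix[OF q(1), of "\<lambda>k. t _ k"]
    by (simp add: doubly_substochastic_def)
  then have "(\<Sum>i<n. B (p i) * (\<Sum>k<n. t (p i) (q k) * v (q k))) \<le> (\<Sum>i<n. B (p i) * v (q i))"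
    by (rule doubly_substochastic_sorted_le) (use p q B v in auto)
  also have "\<dots> = (\<Sum>i<n. B ((p \<circ> inv q) i) * v i)"
    using reix[OF q(1), of "\<lambda>i. B ((p \<circ> inv q) i) * v i"] permutes_inverses[OF q(1)] by simp
  also have "\<dots> \<le> M"
    using p(1) q(1) by (intro M permutes_compose permutes_inv)
  also have "(\<Sum>i<n. B (p i) * (\<Sum>k<n. t (p i) (q k) * v (q k))) = (\<Sum>i<n. B i * (\<Sum>k<n. t i k * v k))"
    using reix[OF p(1), of "\<lambda>i. B i * (\<Sum>k<n. t i k * v k)"] reix[OF q(1), of "\<lambda>k. t _ k * v k"] by simp
  finally show ?thesis .
qed

section \<open>Finite-dimensional Hahn-Banach theorem\<close>

definition sublinear :: "('a::real_vector \<Rightarrow> real) \<Rightarrow> bool" where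
  "sublinear p \<longleftrightarrow> (\<forall>x y. p (x + y) \<le> p x + p y) \<and> (\<forall>c\<ge>0. \<forall>x. p (c *\<^sub>R x) = c * p x)"

lemma sublinear_add: "sublinear p \<Longrightarrow> p (x + y) \<le> p x + p y"
  and sublinear_scaleR: "sublinear p \<Longrightarrow> c \<ge> 0 \<Longrightarrow> p (c *\<^sub>R x) = c * p x"
  by (auto simp: sublinear_def)

lemma sublinear_0: "sublinear p \<Longrightarrow> p 0 = 0"
  using sublinear_scaleR[of p 0 0] by simp

lemma sublinear_neg: "sublinear p \<Longrightarrow> 0 \<le> p x + p (- x)"
  using sublinear_add[of p x "- x"] sublinear_0[of p] by simp

text \<open>One Hahn-Banach step: \<open>p\<close> is lowered to the infimum of
  \<open>p (x + t *\<^sub>R v) - t * p v\<close> over \<open>t \<ge> 0\<close>. The result is linear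
  on the line through \<open>v\<close> and keeps the value \<open>p v\<close> at
  \<open>v\<close>.\<close>

lemma sublinear_linearize_at:
  fixes p :: "'a::real_vector \<Rightarrow> real"
  assumes p: "sublinear p"
  obtains q where "sublinear q" "\<And>x. q x \<le> p x" "q (- v) \<le> - p v"
proof -
  define g where "g x t = p (x + t *\<^sub>R v) - t * p v" for x t
  define q where "q x = (INF t\<in>{0..}. g x t)" for x
  have lower: "- p (- x) \<le> g x t" if "t \<ge> 0" for x t
    using sublinear_add[OF p, of "x + t *\<^sub>R v" "- x"] sublinear_scaleR[OF p that, of v]
    by (simp add: g_def)
  have bdd: "bdd_below (g x ` {0..})" for x
    using lower by (intro bdd_belowI[of _ "- p (- x)"]) auto
  have q_le: "q x \<le> g x t" if "t \<ge> 0" for x t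
    unfolding q_def using bdd that by (intro cINF_lower) auto
  have q_ge: "c \<le> q x" if "\<And>t. t \<ge> 0 \<Longrightarrow> c \<le> g x t" for c x
    unfolding q_def using that by (intro cINF_greatest) auto
  have add: "q (x + y) \<le> q x + q y" for x y
  proof -
    have 1: "q (x + y) \<le> g x t + g y s" if "t \<ge> 0" "s \<ge> 0" for t s
    proof -
      have "q (x + y) \<le> g (x + y) (t + s)" using that by (intro q_le) simp
      also have "\<dots> \<le> g x t + g y s"
        using sublinear_add[OF p, of "x + t *\<^sub>R v" "y + s *\<^sub>R v"]
        by (simp add: g_def algebra_simps)
      finally show ?thesis .
    qed
    have 2: "q (x + y) - g x t \<le> q y" if "t \<ge> 0" for t
      using 1[OF that] by (intro q_ge) (simp add: algebra_simps)
    have "q (x + y) - q y \<le> q x"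
    proof (rule q_ge)
      fix t :: real assume "t \<ge> 0"
      then show "q (x + y) - q y \<le> g x t" using 2[of t] by simp
    qed
    then show ?thesis by simp
  qed
  have le: "q (c *\<^sub>R x) \<le> c * q x" if "c > 0" for c x
  proof -
    have "q (c *\<^sub>R x) / c \<le> q x"
    proof (rule q_ge)
      fix t :: real assume t: "t \<ge> 0"
      have "q (c *\<^sub>R x) \<le> g (c *\<^sub>R x) (c * t)" using that t by (intro q_le) auto
      also have "\<dots> = c * g x t"
        using sublinear_scaleR[OF p, of c "x + t *\<^sub>R v"] that
        by (simp add: g_def algebra_simps)
      finally show "q (c *\<^sub>R x) / c \<le> g x t" using that by (simp add: field_simps)
    qed
    then show ?thesis using that by (simp add: field_simps)
  qed
  have scale: "q (c *\<^sub>R x) = c * q x" if "c > 0" for c x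
    using le[OF that, of x] le[of "inverse c" "c *\<^sub>R x"] that by (simp add: field_simps)
  have "q 0 = 0"
    using q_le[of 0 0] q_ge[of 0 0] sublinear_0[OF p] lower[of _ 0] by (auto simp: g_def intro: antisym)
  then have "q (c *\<^sub>R x) = c * q x" if "c \<ge> 0" for c x
    using that scale[of c x] by (cases "c = 0") auto
  then have "sublinear q" using add by (simp add: sublinear_def)
  moreover have "q x \<le> p x" for x using q_le[of 0 x] by (simp add: g_def)
  moreover have "q (- v) \<le> - p v" using q_le[of 1 "- v"] sublinear_0[OF p] by (simp add: g_def)
  ultimately show ?thesis using that by blast
qed

text \<open>The directions are treated one by one. Linearity along an earlier \<open>u\<close>
  survives a later decrease, as \<open>q' (- u) \<le> - q u \<le> - q' u\<close> and sublinearity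
  gives the reverse inequality.\<close>

lemma sublinear_linearize_on:
  fixes p :: "'a::real_vector \<Rightarrow> real"
  assumes "finite V" "sublinear p"
  obtains q where "sublinear q" "\<And>x. q x \<le> p x" "\<And>v. v \<in> V \<Longrightarrow> q (- v) = - q v"
  using assms
proof (induction V arbitrary: thesis rule: finite_induct)
  case empty
  then show ?case by auto
next
  case (insert v V)
  obtain q where q: "sublinear q" "\<And>x. q x \<le> p x" "\<And>v. v \<in> V \<Longrightarrow> q (- v) = - q v"
    using insert.IH insert.prems(2) by blast
  obtain q' where q': "sublinear q'" "\<And>x. q' x \<le> q x" "q' (- v) \<le> - q v"
    using sublinear_linearize_at[OF q(1)] by blast
  show ?case
  proof (rule insert.prems(1)[OF q'(1)])
    show "q' x \<le> p x" for x using q(2) q'(2) order_trans by blast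
    show "q' (- u) = - q' u" if "u \<in> insert v V" for u
    proof -
      have "q' (- u) \<le> - q u" using that q'(2)[of "- u"] q'(3) q(3) by auto
      then show ?thesis using q'(2)[of u] sublinear_neg[OF q'(1), of u] by simp
    qed
  qed
qed

lemma sublinear_linear_combination:
  assumes q: "sublinear q" and "finite I" "\<And>i. i \<in> I \<Longrightarrow> q (- v i) = - q (v i)"
  shows "q (\<Sum>i\<in>I. c i *\<^sub>R v i) = (\<Sum>i\<in>I. c i * q (v i))"
  using assms(2,3)
proof (induction I rule: finite_induct)
  case empty
  then show ?case using sublinear_0[OF q] by simp
next
  case (insert j I)
  have scale: "q (c *\<^sub>R v j) = c * q (v j)" for c
  proof (cases "c \<ge> 0")
    case False
    then show ?thesis
      using sublinear_scaleR[OF q, of "- c" "- v j"] insert.prems[of j] by simp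
  qed (use sublinear_scaleR[OF q] in auto)
  let ?x = "\<Sum>i\<in>I. c i *\<^sub>R v i"
  have "q ?x \<le> q (?x + c j *\<^sub>R v j) + q (- (c j) *\<^sub>R v j)"
    using sublinear_add[OF q, of "?x + c j *\<^sub>R v j" "- (c j) *\<^sub>R v j"] by simp
  then have "q (?x + c j *\<^sub>R v j) = q ?x + c j * q (v j)"
    using sublinear_add[OF q, of ?x "c j *\<^sub>R v j"] unfolding scale by simp
  then show ?case using insert by (simp add: add.commute)
qed

text \<open>Linearizing first at the combination with coefficients \<open>r\<close> makes the bound
  attained there; linearizing afterwards at every \<open>v i\<close> makes the functional linear on
  their span, and \<open>b i\<close> is its value at \<open>v i\<close>.\<close>

lemma hahn_banach_finite:
  fixes p :: "'a::real_vector \<Rightarrow> real"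
  assumes "sublinear p" "finite I"
  shows "\<exists>b. (\<forall>c. (\<Sum>i\<in>I. c i * b i) \<le> p (\<Sum>i\<in>I. c i *\<^sub>R v i)) \<and>
    (\<Sum>i\<in>I. r i * b i) = p (\<Sum>i\<in>I. r i *\<^sub>R v i)"
proof -
  let ?r = "\<Sum>i\<in>I. r i *\<^sub>R v i"
  obtain p' where p': "sublinear p'" "\<And>x. p' x \<le> p x" "p' (- ?r) \<le> - p ?r"
    using sublinear_linearize_at[OF assms(1)] by blast
  obtain q where q: "sublinear q" "\<And>x. q x \<le> p' x" "\<And>u. u \<in> v ` I \<Longrightarrow> q (- u) = - q u"
    using sublinear_linearize_on[OF finite_imageI[OF assms(2)] p'(1)] by blast
  have comb: "q (\<Sum>i\<in>I. c i *\<^sub>R v i) = (\<Sum>i\<in>I. c i * q (v i))" for c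
    using q(3) by (intro sublinear_linear_combination[OF q(1) assms(2)]) auto
  have le: "q x \<le> p x" for x using q(2) p'(2) order_trans by blast
  have "p ?r \<le> q ?r" using p'(3) q(2)[of "- ?r"] sublinear_neg[OF q(1), of ?r] by simp
  then have "q ?r = p ?r" using le[of ?r] by simp
  then show ?thesis
    using le[of "\<Sum>i\<in>I. _ i *\<^sub>R v i"] unfolding comb by (intro exI[of _ "\<lambda>i. q (v i)"]) auto
qed

section \<open>Normed spaces and unconditional summability\<close>

definition truncate :: "nat \<Rightarrow> (nat \<Rightarrow> real) \<Rightarrow> nat \<Rightarrow> real" where
  "truncate n y = (\<lambda>k. if k < n then y k else 0)"

lemma truncate_apply [simp]: "truncate n y k = (if k < n then y k else 0)"
  by (simp add: truncate_def)

lemma sum_fun_apply: "(\<Sum>i\<in>I. f i) x = (\<Sum>i\<in>I. f i x)"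
  by (induction I rule: infinite_finite_induct) auto

lemma truncate_eq_sum: "truncate n y = (\<Sum>k<n. y k *\<^sub>R unit_vec k)"
  by (rule ext) (simp add: sum_fun_apply unit_vec_def if_distrib cong: if_cong)

lemma truncate_add: "truncate n (x + y) = truncate n x + truncate n y"
  and truncate_scaleR: "truncate n (c *\<^sub>R x) = c *\<^sub>R truncate n x"
  by (auto simp: fun_eq_iff)

context normed_space_on
begin

lemma zero_mem: "0 \<in> X"
  and scaleR_mem: "x \<in> X \<Longrightarrow> c *\<^sub>R x \<in> X"
  and diff_mem: "x \<in> X \<Longrightarrow> y \<in> X \<Longrightarrow> x - y \<in> X"
  and sum_mem: "(\<And>i. i \<in> I \<Longrightarrow> f i \<in> X) \<Longrightarrow> (\<Sum>i\<in>I. f i) \<in> X"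
  using subspace_X by (auto simp: subspace_0 subspace_scale subspace_diff subspace_sum)

lemma nrm_0: "nrm 0 = 0"
  using norm_eq_0 zero_mem by blast

lemma nrm_minus: "x \<in> X \<Longrightarrow> nrm (- x) = nrm x"
  using norm_scaleR[of x "- 1"] by simp

lemma nrm_nonneg: "x \<in> X \<Longrightarrow> 0 \<le> nrm x"
  using norm_triangle[of x "- x"] nrm_0 nrm_minus scaleR_mem[of x "- 1"] by simp

lemma nrm_diff_commute: "x \<in> X \<Longrightarrow> y \<in> X \<Longrightarrow> nrm (x - y) = nrm (y - x)"
  using nrm_minus[of "x - y"] diff_mem by simp

lemma nrm_triangle_diff:
  assumes "x \<in> X" "y \<in> X" "z \<in> X"
  shows "nrm (x - z) \<le> nrm (x - y) + nrm (y - z)"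
  using norm_triangle[of "x - y" "y - z"] assms diff_mem by simp

lemma nrm_sum_le: "(\<And>i. i \<in> I \<Longrightarrow> f i \<in> X) \<Longrightarrow> nrm (\<Sum>i\<in>I. f i) \<le> (\<Sum>i\<in>I. nrm (f i))"
proof (induction I rule: infinite_finite_induct)
  case (insert i I)
  then show ?case using norm_triangle[of "f i" "\<Sum>i\<in>I. f i"] sum_mem[of I f] by fastforce
qed (simp_all add: nrm_0)

end

text \<open>
  The permutation lists the elements of bad blocks consecutively, so that the failure of the
  Cauchy condition for finite sums shows up in the partial sums of one rearranged series.
\<close>

lemma ex_block_permutation:
  fixes P :: "nat set \<Rightarrow> bool"
  assumes "\<And>M. \<exists>F. finite F \<and> F \<subseteq> {M..} \<and> P F"
  shows "\<exists>\<pi> :: nat \<Rightarrow> nat. bij \<pi> \<and> (\<forall>M. \<exists>a\<ge>M. \<exists>b. P (\<pi> ` {a..<b}))"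
proof -
  obtain F where F: "\<And>M. finite (F M)" "\<And>M. F M \<subseteq> {M..}" "\<And>M. P (F M)"
    using assms by metis
  \<comment> \<open>The block from \<open>M\<close> to \<open>nxt M\<close> contains
    \<open>F M\<close>; inserting \<open>0\<close> gives \<open>Max\<close> a meaning when
    \<open>F M\<close> is empty.\<close>
  define nxt where "nxt M = Suc (M + Max (insert 0 (F M)))" for M
  have nxt: "M < nxt M" "F M \<subseteq> {M..<nxt M}" for M
  proof -
    show "M < nxt M" by (simp add: nxt_def)
    have "k \<le> Max (insert 0 (F M))" if "k \<in> F M" for k using that F(1) by (intro Max_ge) auto
    then show "F M \<subseteq> {M..<nxt M}" using F(2)[of M] by (fastforce simp: nxt_def)
  qed
  define q where "q j = (nxt ^^ j) 0" for j
  have q: "q 0 = 0" "q (Suc j) = nxt (q j)" for j by (auto simp: q_def)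
  have q_strict: "strict_mono q" by (rule strict_monoI_Suc) (simp add: q nxt)
  define I where "I j = {q j..<q (Suc j)}" for j
  \<comment> \<open>Within its block, the bad set is moved to the first positions, and the remaining
    elements fill the remaining positions.\<close>
  have "\<exists>f. bij_betw f (I j) (I j) \<and> f ` {q j..<q j + card (F (q j))} = F (q j)" for j
  proof -
    let ?F = "F (q j)" and ?A = "{q j..<q j + card (F (q j))}"
    have FI: "?F \<subseteq> I j" using nxt(2)[of "q j"] by (simp add: I_def q)
    have "card ?F \<le> card (I j)" using FI by (intro card_mono) (auto simp: I_def)
    then have AI: "?A \<subseteq> I j" using nxt(1)[of "q j"] by (auto simp: I_def q)
    have "card ?A = card ?F" by simp
    then obtain g where g: "bij_betw g ?A ?F"
      using F(1) finite_same_card_bij by (metis finite_atLeastLessThan)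
    have "card (I j - ?A) = card (I j - ?F)"
      using FI AI F(1) by (simp add: card_Diff_subset)
    then obtain h where h: "bij_betw h (I j - ?A) (I j - ?F)"
      using finite_same_card_bij by (metis I_def finite_Diff finite_atLeastLessThan)
    define f where "f k = (if k \<in> ?A then g k else h k)" for k
    have "bij_betw f (?A \<union> (I j - ?A)) (?F \<union> (I j - ?F))"
    proof (rule bij_betw_combine)
      show "bij_betw f ?A ?F" using g by (subst bij_betw_cong[of _ _ g]) (auto simp: f_def)
      show "bij_betw f (I j - ?A) (I j - ?F)" using h by (subst bij_betw_cong[of _ _ h]) (auto simp: f_def)
    qed auto
    then have "bij_betw f (I j) (I j)" using FI AI by (simp add: Un_absorb1)
    moreover have "f ` ?A = ?F" using g by (auto simp: f_def bij_betw_def)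
    ultimately show ?thesis by blast
  qed
  then obtain f where f: "\<And>j. bij_betw (f j) (I j) (I j)"
    "\<And>j. f j ` {q j..<q j + card (F (q j))} = F (q j)" by metis
  have disj: "j = j'" if "k \<in> I j" "k \<in> I j'" for j j' k
  proof (rule ccontr)
    assume "j \<noteq> j'"
    then consider "Suc j \<le> j'" | "Suc j' \<le> j" by linarith
    then show False
      using that strict_mono_less_eq[OF q_strict, of "Suc j" j'] strict_mono_less_eq[OF q_strict, of "Suc j'" j]
      by cases (auto simp: I_def)
  qed
  have cover: "\<exists>j. k \<in> I j" for k
  proof -
    have "k < q (Suc k)" using strict_mono_imp_increasing[OF q_strict, of "Suc k"] by simp
    then have ex: "\<exists>j. k < q (Suc j)" by blast
    define j where "j = (LEAST j. k < q (Suc j))"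
    have "k < q (Suc j)" unfolding j_def using ex by (rule LeastI_ex)
    moreover have "q j \<le> k"
    proof (cases j)
      case (Suc i)
      then have "\<not> k < q (Suc i)" unfolding j_def using not_less_Least by (metis lessI)
      then show ?thesis using Suc by simp
    qed (simp add: q)
    ultimately show ?thesis by (auto simp: I_def)
  qed
  define \<pi> where "\<pi> k = f (THE j. k \<in> I j) k" for k
  have \<pi>: "\<pi> k = f j k" if "k \<in> I j" for k j
    using disj that unfolding \<pi>_def by (metis (mono_tags, lifting) the_equality)
  have "bij_betw \<pi> (\<Union>j. I j) (\<Union>j. I j)"
  proof (rule bij_betw_UNION_disjoint)
    show "disjoint_family_on I UNIV" using disj by (auto simp: disjoint_family_on_def)
    show "bij_betw \<pi> (I j) (I j)" for j
      using f(1)[of j] by (subst bij_betw_cong[of _ _ "f j"]) (auto simp: \<pi>)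
  qed
  moreover have "(\<Union>j. I j) = UNIV" using cover by auto
  ultimately have "bij \<pi>" by simp
  \<comment> \<open>The block with index \<open>M\<close> serves, because it starts at
    \<open>q M\<close> and \<open>M \<le> q M\<close>.\<close>
  moreover have "\<exists>a\<ge>M. \<exists>b. P (\<pi> ` {a..<b})" for M
  proof -
    have "card (F (q M)) \<le> card (I M)"
      using nxt(2)[of "q M"] by (intro card_mono) (auto simp: I_def q)
    then have "{q M..<q M + card (F (q M))} \<subseteq> I M" using nxt(1)[of "q M"] by (auto simp: I_def q)
    then have "\<pi> ` {q M..<q M + card (F (q M))} = f M ` {q M..<q M + card (F (q M))}"
      by (intro image_cong) (auto simp: \<pi>)
    then show ?thesis using f(2)[of M] F(3) strict_mono_imp_increasing[OF q_strict, of M] by metis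
  qed
  ultimately show ?thesis by blast
qed

text \<open>If finite sums of norm at least \<open>1\<close> existed arbitrarily far out, some
  rearranged series would violate the Cauchy condition. Hence the far part of every finite sum has
  norm below \<open>1\<close>, and the near part involves only finitely many terms.\<close>

lemma (in normed_space_on) unconditionally_summable_bounded:
  assumes "unconditionally_summable X nrm x"
  obtains K where "\<And>F. finite F \<Longrightarrow> nrm (\<Sum>i\<in>F. x i) \<le> K"
proof -
  have xX: "x i \<in> X" for i using assms by (simp add: unconditionally_summable_def)
  have "\<exists>M. \<forall>F. finite F \<longrightarrow> F \<subseteq> {M..} \<longrightarrow> nrm (\<Sum>i\<in>F. x i) < 1"
  proof (rule ccontr)
    assume "\<not> ?thesis"
    then have "\<exists>F. finite F \<and> F \<subseteq> {M..} \<and> 1 \<le> nrm (\<Sum>i\<in>F. x i)" for M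
      by (meson not_le)
    from ex_block_permutation[of "\<lambda>F. 1 \<le> nrm (\<Sum>i\<in>F. x i)", OF this]
    obtain \<pi> :: "nat \<Rightarrow> nat" where \<pi>: "bij \<pi>" "\<And>M. \<exists>a\<ge>M. \<exists>b. 1 \<le> nrm (\<Sum>i\<in>\<pi> ` {a..<b}. x i)"
      by blast
    define S where "S m = (\<Sum>i<m. x (\<pi> i))" for m
    have SX: "S m \<in> X" for m unfolding S_def by (intro sum_mem xX)
    obtain s where s: "s \<in> X" "(\<lambda>m. nrm (S m - s)) \<longlonglongrightarrow> 0"
      using assms \<pi>(1) unfolding unconditionally_summable_def S_def by blast
    from s(2) have "\<forall>\<^sub>F m in sequentially. nrm (S m - s) < 1 / 2" by (rule order_tendstoD) simp
    then obtain M where M: "\<And>m. m \<ge> M \<Longrightarrow> nrm (S m - s) < 1 / 2"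
      by (auto simp: eventually_sequentially)
    obtain a b where ab: "a \<ge> M" "1 \<le> nrm (\<Sum>i\<in>\<pi> ` {a..<b}. x i)" using \<pi>(2) by blast
    have "a < b" using ab(2) nrm_0 by (cases "a < b") auto
    have "(\<Sum>i\<in>\<pi> ` {a..<b}. x i) = (\<Sum>i\<in>{a..<b}. x (\<pi> i))"
      using \<pi>(1) by (subst sum.reindex) (auto simp: bij_def inj_on_def)
    also have "\<dots> = S b - S a"
      using sum_diff_nat_ivl[of 0 a b "\<lambda>i. x (\<pi> i)"] \<open>a < b\<close> by (simp add: S_def atLeast0LessThan)
    finally have "1 \<le> nrm (S b - s) + nrm (s - S a)"
      using ab(2) nrm_triangle_diff[OF SX s(1) SX, of b a] by simp
    then show False
      using M[of a] M[of b] ab(1) \<open>a < b\<close> nrm_diff_commute[OF s(1) SX, of a] by simp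
  qed
  then obtain M where M: "\<And>F. finite F \<Longrightarrow> F \<subseteq> {M..} \<Longrightarrow> nrm (\<Sum>i\<in>F. x i) < 1" by blast
  have "nrm (\<Sum>i\<in>F. x i) \<le> (\<Sum>i<M. nrm (x i)) + 1" if F: "finite F" for F
  proof -
    have "(\<Sum>i\<in>F. x i) = (\<Sum>i\<in>F \<inter> {..<M}. x i) + (\<Sum>i\<in>F - {..<M}. x i)"
      using sum.Int_Diff[OF F] .
    then have "nrm (\<Sum>i\<in>F. x i) \<le> nrm (\<Sum>i\<in>F \<inter> {..<M}. x i) + nrm (\<Sum>i\<in>F - {..<M}. x i)"
      using norm_triangle[OF sum_mem sum_mem] xX by metis
    moreover have "nrm (\<Sum>i\<in>F \<inter> {..<M}. x i) \<le> (\<Sum>i\<in>F \<inter> {..<M}. nrm (x i))"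
      by (rule nrm_sum_le) (rule xX)
    moreover have "\<dots> \<le> (\<Sum>i<M. nrm (x i))"
      using nrm_nonneg[OF xX] by (intro sum_mono2) auto
    moreover have "nrm (\<Sum>i\<in>F - {..<M}. x i) < 1" using F by (intro M) auto
    ultimately show ?thesis by linarith
  qed
  then show ?thesis using that by blast
qed

text \<open>Taking images under \<open>p\<close> permutes the finite sets with at most
  \<open>n\<close> elements, so both infima run over the same suprema.\<close>

lemma decreasing_rearrangement_comp_bij:
  fixes p :: "nat \<Rightarrow> nat"
  assumes "bij p"
  shows "decreasing_rearrangement (x \<circ> p) = decreasing_rearrangement x"
proof
  fix n
  have inj: "inj p" using assms by (simp add: bij_def)
  have img: "(\<lambda>J. p ` J) ` {J. finite J \<and> card J \<le> n} = {J. finite J \<and> card J \<le> n}"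
  proof (intro equalityI subsetI)
    fix J :: "nat set" assume J: "J \<in> {J. finite J \<and> card J \<le> n}"
    have "p ` (p -` J) = J" using assms by (simp add: bij_def surj_image_vimage_eq)
    moreover have "finite (p -` J)" using J inj by (auto intro: finite_vimageI)
    moreover have "card (p -` J) = card J"
      using card_vimage_inj[OF inj] assms by (simp add: bij_def)
    ultimately show "J \<in> (\<lambda>J. p ` J) ` {J. finite J \<and> card J \<le> n}"
      using J by (intro image_eqI[of _ _ "p -` J"]) auto
  qed (use inj in \<open>auto simp: card_image inj_on_subset\<close>)
  have shift: "(SUP i\<in>- J. \<bar>(x \<circ> p) i\<bar>) = (SUP i\<in>- (p ` J). \<bar>x i\<bar>)" for J
    unfolding bij_image_Compl_eq[OF assms, symmetric] by (simp only: image_image o_apply)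
  have "(INF J\<in>{J. finite J \<and> card J \<le> n}. SUP i\<in>- (p ` J). \<bar>x i\<bar>) =
        (INF J\<in>(\<lambda>J. p ` J) ` {J. finite J \<and> card J \<le> n}. SUP i\<in>- J. \<bar>x i\<bar>)"
    by (simp only: image_image)
  then show "decreasing_rearrangement (x \<circ> p) n = decreasing_rearrangement x n"
    unfolding decreasing_rearrangement_def shift img .
qed

section \<open>Symmetric 2-concave spaces\<close>

context banach_sequence_space
begin

lemma unit_vec_mem: "unit_vec k \<in> E"
proof -
  obtain x where x: "x \<in> E" "\<And>n. x n \<noteq> 0" using full_support by blast
  have "(1 / x k) *\<^sub>R x \<in> E" using x(1) by (rule scaleR_mem)
  then show ?thesis
    using solid[of "(1 / x k) *\<^sub>R x" "unit_vec k"] x(2) by (simp add: unit_vec_def)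
qed

lemma truncate_mem: "truncate n y \<in> E"
  unfolding truncate_eq_sum by (intro sum_mem scaleR_mem unit_vec_mem)

lemma normE_truncate_le: "x \<in> E \<Longrightarrow> normE (truncate n x) \<le> normE x"
  using solid[of x "truncate n x"] by simp

lemma normE_truncate_mono: "(\<And>k. k < n \<Longrightarrow> \<bar>x k\<bar> \<le> \<bar>y k\<bar>) \<Longrightarrow> normE (truncate n x) \<le> normE (truncate n y)"
  using solid[OF truncate_mem, of "truncate n x" n y] by simp

text \<open>The unit ball of the dual of the span of the first \<open>n\<close> unit vectors, in
  coordinates. As the norm is solid, the absolute values inside the sum do not shrink the ball; they
  make its invariance under changes of sign evident.\<close>

definition dual_ball :: "nat \<Rightarrow> (nat \<Rightarrow> real) set" where
  "dual_ball n = {b. \<forall>y. (\<Sum>k<n. \<bar>b k * y k\<bar>) \<le> normE (truncate n y)}"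

lemma dual_ballD: "b \<in> dual_ball n \<Longrightarrow> (\<Sum>k<n. \<bar>b k * y k\<bar>) \<le> normE (truncate n y)"
  by (simp add: dual_ball_def)

lemma dual_ball_cong_abs: "b \<in> dual_ball n \<Longrightarrow> (\<And>k. \<bar>b' k\<bar> = \<bar>b k\<bar>) \<Longrightarrow> b' \<in> dual_ball n"
  by (simp add: dual_ball_def abs_mult)

text \<open>The Hahn-Banach theorem bounds only sums without absolute values. Applied to
  \<open>z\<close> with its signs adjusted to those of \<open>b\<close>, which does not increase the
  norm, this bound becomes membership in \<open>dual_ball n\<close>.\<close>

lemma dual_ball_norming:
  obtains b where "b \<in> dual_ball n" "(\<Sum>k<n. b k * y k) = normE (truncate n y)"
proof -
  define p where "p x = normE (truncate n x)" for x
  have "sublinear p"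
    unfolding sublinear_def p_def truncate_add truncate_scaleR
    by (simp add: norm_triangle norm_scaleR truncate_mem)
  then obtain b where b: "\<And>c. (\<Sum>k<n. c k * b k) \<le> p (\<Sum>k<n. c k *\<^sub>R unit_vec k)"
    "(\<Sum>k<n. y k * b k) = p (\<Sum>k<n. y k *\<^sub>R unit_vec k)"
    using hahn_banach_finite[of p "{..<n}" unit_vec y] by blast
  have p: "p (\<Sum>k<n. c k *\<^sub>R unit_vec k) = normE (truncate n c)" for c
    unfolding p_def truncate_eq_sum[symmetric] by (rule arg_cong[of _ _ normE]) auto
  have "b \<in> dual_ball n"
    unfolding dual_ball_def
  proof safe
    fix z
    have "(\<Sum>k<n. \<bar>b k * z k\<bar>) = (\<Sum>k<n. (sgn (b k * z k) * z k) * b k)"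
      by (rule sum.cong) (simp_all add: abs_sgn mult_ac)
    also have "\<dots> \<le> normE (truncate n (\<lambda>k. sgn (b k * z k) * z k))"
      using b(1) unfolding p .
    also have "\<dots> \<le> normE (truncate n z)"
      by (intro normE_truncate_mono) (auto simp: abs_mult sgn_real_def)
    finally show "(\<Sum>k<n. \<bar>b k * z k\<bar>) \<le> normE (truncate n z)" .
  qed
  moreover have "(\<Sum>k<n. b k * y k) = normE (truncate n y)"
    using b(2) unfolding p by (simp add: mult.commute)
  ultimately show ?thesis using that by blast
qed

end

section \<open>Consequences of symmetry and 2-concavity\<close>

locale two_concave_symmetric_space = banach_sequence_space +
  fixes C :: real
  assumes symmetric: "symmetric_space E normE"
    and C_pos: "C > 0"
    and two_concave_fun: "(\<And>i. i < n \<Longrightarrow> x i \<in> E) \<Longrightarrow>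
        sqrt (\<Sum>i<n. (normE (x i))\<^sup>2) \<le> C * normE (\<lambda>k. sqrt (\<Sum>i<n. \<bar>x i k\<bar>\<^sup>2))"
    and normE_unit_vec: "normE (unit_vec n) = 1"
begin

lemma two_concave_set:
  fixes I :: "'i set"
  assumes "finite I" "\<And>i. i \<in> I \<Longrightarrow> x i \<in> E"
  shows "sqrt (\<Sum>i\<in>I. (normE (x i))\<^sup>2) \<le> C * normE (\<lambda>k. sqrt (\<Sum>i\<in>I. (x i k)\<^sup>2))"
proof -
  obtain h where h: "bij_betw h {..<card I} I"
    using ex_bij_betw_nat_finite[OF assms(1)] by (auto simp: atLeast0LessThan)
  have reindex: "(\<Sum>i<card I. f (h i)) = (\<Sum>i\<in>I. f i)" for f :: "'i \<Rightarrow> real"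
    by (rule sum.reindex_bij_betw[OF h])
  have "sqrt (\<Sum>i<card I. (normE (x (h i)))\<^sup>2)
      \<le> C * normE (\<lambda>k. sqrt (\<Sum>i<card I. \<bar>x (h i) k\<bar>\<^sup>2))"
  proof (rule two_concave_fun)
    show "x (h i) \<in> E" if "i < card I" for i
      using assms(2) bij_betwE[OF h] that by blast
  qed
  then show ?thesis
    using reindex[of "\<lambda>i. (normE (x i))\<^sup>2"] reindex[of "\<lambda>i. (x i _)\<^sup>2"] by simp
qed

lemma abs_le_normE:
  assumes "x \<in> E"
  shows "\<bar>x k\<bar> \<le> normE x"
proof -
  have "normE (x k *\<^sub>R unit_vec k) \<le> normE x"
    using solid[OF assms, of "x k *\<^sub>R unit_vec k"] by (simp add: unit_vec_def)
  then show ?thesis by (simp add: norm_scaleR unit_vec_mem normE_unit_vec)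
qed

text \<open>This is 2-concavity for the vectors \<open>x i *\<^sub>R unit_vec i\<close>: they are
  disjointly supported, so their square function is the absolute value of
  \<open>truncate n x\<close>.\<close>

lemma l2_partial_sum_le:
  assumes "x \<in> E"
  shows "sqrt (\<Sum>k<n. (x k)\<^sup>2) \<le> C * normE x"
proof -
  have "sqrt (\<Sum>i<n. (x i)\<^sup>2) = sqrt (\<Sum>i<n. (normE (x i *\<^sub>R unit_vec i))\<^sup>2)"
    unfolding norm_scaleR[OF unit_vec_mem] normE_unit_vec by simp
  also have "\<dots> \<le> C * normE (\<lambda>k. sqrt (\<Sum>i<n. ((x i *\<^sub>R unit_vec i) k)\<^sup>2))"
    by (rule two_concave_set) (auto intro: scaleR_mem unit_vec_mem)
  also have "(\<lambda>k. sqrt (\<Sum>i<n. ((x i *\<^sub>R unit_vec i) k)\<^sup>2)) = (\<lambda>k. \<bar>truncate n x k\<bar>)"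
    by (rule ext) (simp add: unit_vec_def if_distrib[of "\<lambda>z. _ * z"] if_distrib[of "\<lambda>z. z\<^sup>2"] cong: if_cong)
  also have "C * normE (\<lambda>k. \<bar>truncate n x k\<bar>) \<le> C * normE x"
    using solid[OF assms, of "\<lambda>k. \<bar>truncate n x k\<bar>"] C_pos by (intro mult_left_mono) auto
  finally show ?thesis .
qed

lemma normE_comp_bij:
  assumes "bij p" "x \<in> E" "x \<circ> p \<in> E"
  shows "normE (x \<circ> p) = normE x"
  using assms symmetric decreasing_rearrangement_comp_bij[OF assms(1), of x]
  unfolding symmetric_space_def by metis

text \<open>The permutation is shifted to the test sequence, where \<open>inv p\<close> commutes
  with truncation and preserves the norm by symmetry.\<close>

lemma dual_ball_permute:
  assumes b: "b \<in> dual_ball n" and p: "p permutes {..<n}"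
  shows "b \<circ> p \<in> dual_ball n"
  unfolding dual_ball_def
proof safe
  fix y
  have less: "inv p k < n \<longleftrightarrow> k < n" for k
    using permutes_in_image[OF permutes_inv[OF p], of k] by simp
  have "(\<Sum>k<n. \<bar>(b \<circ> p) k * y k\<bar>) = (\<Sum>k<n. \<bar>b k * (y \<circ> inv p) k\<bar>)"
    using sum.permute[OF p, of "\<lambda>k. \<bar>b k * (y \<circ> inv p) k\<bar>"] permutes_inverses[OF p] by (simp add: o_def)
  also have "\<dots> \<le> normE (truncate n (y \<circ> inv p))" by (rule dual_ballD[OF b])
  also have "truncate n (y \<circ> inv p) = truncate n y \<circ> inv p" using less by (auto simp: fun_eq_iff)
  also have "normE (truncate n y \<circ> inv p) = normE (truncate n y)"
  proof (rule normE_comp_bij)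
    show "truncate n y \<circ> inv p \<in> E"
      unfolding \<open>truncate n (y \<circ> inv p) = truncate n y \<circ> inv p\<close>[symmetric] by (rule truncate_mem)
  qed (use permutes_bij[OF permutes_inv[OF p]] truncate_mem in auto)
  finally show "(\<Sum>k<n. \<bar>(b \<circ> p) k * y k\<bar>) \<le> normE (truncate n y)" .
qed

text \<open>This is \<open>2\<close>-convexity of the dual norm, the dual form of \<open>2\<close>-concavity.\<close>

lemma sqrt_convex_hull_dual_ball:
  assumes "\<beta> \<in> convex hull ((\<lambda>b k. (b k)\<^sup>2) ` dual_ball n)"
  shows "\<beta> k \<ge> 0" and "(\<lambda>k. sqrt (\<beta> k) / C) \<in> dual_ball n"
proof -
  obtain S u where S: "finite S" "S \<subseteq> (\<lambda>b k. (b k)\<^sup>2) ` dual_ball n"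
    "\<And>v. v \<in> S \<Longrightarrow> 0 \<le> u v" "sum u S = 1" "(\<Sum>v\<in>S. u v *\<^sub>R v) = \<beta>"
    using assms unfolding convex_hull_explicit by blast
  have "\<forall>v\<in>S. \<exists>b\<in>dual_ball n. v = (\<lambda>k. (b k)\<^sup>2)" using S(2) by blast
  then obtain b where b: "\<And>v. v \<in> S \<Longrightarrow> b v \<in> dual_ball n" "\<And>v. v \<in> S \<Longrightarrow> v = (\<lambda>k. (b v k)\<^sup>2)"
    by metis
  have \<beta>: "\<beta> k = (\<Sum>v\<in>S. u v * (b v k)\<^sup>2)" for k
  proof -
    have "\<beta> k = (\<Sum>v\<in>S. u v * v k)" unfolding S(5)[symmetric] by (simp add: sum_fun_apply)
    also have "\<dots> = (\<Sum>v\<in>S. u v * (b v k)\<^sup>2)" using b(2) by (intro sum.cong refl) metis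
    finally show ?thesis .
  qed
  show nn: "\<beta> k \<ge> 0" for k unfolding \<beta> using S(3) by (intro sum_nonneg) auto
  show "(\<lambda>k. sqrt (\<beta> k) / C) \<in> dual_ball n"
    unfolding dual_ball_def
  proof safe
    fix y
    \<comment> \<open>The pieces \<open>z v\<close> have square function \<open>|y|\<close> wherever
      \<open>\<beta>\<close> is nonzero, and their pairings with \<open>b v\<close>, weighted by
      \<open>sqrt (u v)\<close>, add up to \<open>sqrt (\<beta> k) * |y k|\<close>. Cauchy-Schwarz
      over \<open>v\<close> then produces the square sum that 2-concavity bounds. Where
      \<open>\<beta> k = 0\<close>, the quotient is \<open>0\<close>.\<close>
    define z where "z v k = y k * (sqrt (u v) * b v k / sqrt (\<beta> k))" for v k
    have z2: "(\<Sum>v\<in>S. (z v k)\<^sup>2) = (if \<beta> k = 0 then 0 else (y k)\<^sup>2)" for k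
    proof -
      have "(\<Sum>v\<in>S. (z v k)\<^sup>2) = (y k)\<^sup>2 / \<beta> k * (\<Sum>v\<in>S. u v * (b v k)\<^sup>2)"
        unfolding sum_distrib_left z_def using S(3) nn
        by (intro sum.cong) (auto simp: power_mult_distrib power_divide)
      then show ?thesis by (simp flip: \<beta>)
    qed
    have "(\<Sum>k<n. sqrt (\<beta> k) * \<bar>y k\<bar>) = (\<Sum>k<n. \<Sum>v\<in>S. sqrt (u v) * \<bar>b v k * z v k\<bar>)"
    proof (rule sum.cong)
      fix k
      have "sqrt (\<beta> k) * \<bar>y k\<bar> = \<beta> k / sqrt (\<beta> k) * \<bar>y k\<bar>"
        using nn[of k] by (simp add: real_div_sqrt)
      also have "\<dots> = (\<Sum>v\<in>S. u v * (b v k)\<^sup>2 / sqrt (\<beta> k) * \<bar>y k\<bar>)"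
        by (subst \<beta>) (simp add: sum_distrib_right sum_divide_distrib)
      also have "\<dots> = (\<Sum>v\<in>S. sqrt (u v) * \<bar>b v k * z v k\<bar>)"
      proof (rule sum.cong)
        fix v assume "v \<in> S"
        then have "u v = sqrt (u v) * sqrt (u v)" using S(3) by simp
        then have "u v * (b v k)\<^sup>2 / sqrt (\<beta> k) * \<bar>y k\<bar>
            = sqrt (u v) * sqrt (u v) * (\<bar>b v k\<bar> * \<bar>b v k\<bar>) / sqrt (\<beta> k) * \<bar>y k\<bar>"
          by (simp add: power2_eq_square)
        moreover have "\<bar>z v k\<bar> = \<bar>y k\<bar> * (sqrt (u v) * \<bar>b v k\<bar> / sqrt (\<beta> k))"
          using \<open>v \<in> S\<close> S(3) nn[of k] by (simp add: z_def abs_mult)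
        ultimately show "u v * (b v k)\<^sup>2 / sqrt (\<beta> k) * \<bar>y k\<bar> = sqrt (u v) * \<bar>b v k * z v k\<bar>"
          by (simp only: abs_mult times_divide_eq_left times_divide_eq_right mult_ac)
      qed simp
      finally show "sqrt (\<beta> k) * \<bar>y k\<bar> = (\<Sum>v\<in>S. sqrt (u v) * \<bar>b v k * z v k\<bar>)" .
    qed simp
    also have "\<dots> = (\<Sum>v\<in>S. sqrt (u v) * (\<Sum>k<n. \<bar>b v k * z v k\<bar>))"
      by (subst sum.swap) (simp add: sum_distrib_left)
    also have "\<dots> \<le> (\<Sum>v\<in>S. sqrt (u v) * normE (truncate n (z v)))"
      using S(3) b(1) by (intro sum_mono mult_left_mono dual_ballD) auto
    also have "\<dots> \<le> sqrt (\<Sum>v\<in>S. (sqrt (u v))\<^sup>2) * sqrt (\<Sum>v\<in>S. (normE (truncate n (z v)))\<^sup>2)"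
      unfolding real_sqrt_mult[symmetric] by (intro real_le_rsqrt Cauchy_Schwarz_ineq_sum)
    also have "(\<Sum>v\<in>S. (sqrt (u v))\<^sup>2) = 1" using S(3,4) by simp
    also have "sqrt (\<Sum>v\<in>S. (normE (truncate n (z v)))\<^sup>2)
        \<le> C * normE (\<lambda>k. sqrt (\<Sum>v\<in>S. (truncate n (z v) k)\<^sup>2))"
      by (rule two_concave_set[OF S(1) truncate_mem])
    also have "\<dots> \<le> C * normE (truncate n y)"
    proof (rule mult_left_mono)
      have "\<bar>sqrt (\<Sum>v\<in>S. (truncate n (z v) k)\<^sup>2)\<bar> \<le> \<bar>truncate n y k\<bar>" for k
        by (simp add: z2)
      then show "normE (\<lambda>k. sqrt (\<Sum>v\<in>S. (truncate n (z v) k)\<^sup>2)) \<le> normE (truncate n y)"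
        using solid[OF truncate_mem, of "\<lambda>k. sqrt (\<Sum>v\<in>S. (truncate n (z v) k)\<^sup>2)" n y] by blast
    qed (use C_pos in simp)
    finally have "(\<Sum>k<n. sqrt (\<beta> k) * \<bar>y k\<bar>) \<le> C * normE (truncate n y)" by simp
    then have "(\<Sum>k<n. sqrt (\<beta> k) * \<bar>y k\<bar>) / C \<le> normE (truncate n y)"
      using C_pos by (simp add: field_simps)
    moreover have "(\<Sum>k<n. \<bar>sqrt (\<beta> k) / C * y k\<bar>) = (\<Sum>k<n. sqrt (\<beta> k) * \<bar>y k\<bar>) / C"
      unfolding sum_divide_distrib using C_pos nn by (intro sum.cong) (auto simp: abs_mult)
    ultimately show "(\<Sum>k<n. \<bar>sqrt (\<beta> k) / C * y k\<bar>) \<le> normE (truncate n y)" by simp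
  qed
qed

text \<open>Both assertions of the theorem rest on this estimate. Its constant collects
  \<open>sqrt 3\<close> from Khinchine's inequality, \<open>C\<close> from the passage to the convex
  hull of the squares, and \<open>4\<close> from adding two weight bounds of
  \<open>2 * W'\<close>.\<close>

lemma matrix_row_norms_le:
  fixes x :: "nat \<Rightarrow> nat \<Rightarrow> real"
  assumes W: "W > 0" "\<And>b. b \<in> dual_ball n \<Longrightarrow> (\<Sum>i<n. \<bar>\<Sum>k<n. b k * x i k\<bar>) \<le> W"
  shows "normE (truncate n (\<lambda>i. sqrt (\<Sum>k<n. (x i k)\<^sup>2))) \<le> 4 * sqrt 3 * C * W"
proof -
  define D where "D = convex hull ((\<lambda>b k. (b k)\<^sup>2) ` dual_ball n)"
  define W' where "W' = sqrt 3 * C * W"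
  have W': "W' > 0" using W(1) C_pos by (simp add: W'_def)
  define c where "c k = sqrt (\<Sum>i<n. (x i k)\<^sup>2)" for k
  \<comment> \<open>The signs of the columns are absorbed by \<open>b\<close>, since the dual ball
    is invariant under changes of sign.\<close>
  have rows: "(\<Sum>i<n. sqrt (\<Sum>k<n. (b k)\<^sup>2 * (x i k)\<^sup>2)) \<le> sqrt 3 * W" if b: "b \<in> dual_ball n" for b
    unfolding power_mult_distrib[symmetric]
  proof (rule sum_row_norms_le)
    fix \<epsilon> :: "nat \<Rightarrow> real" assume \<epsilon>: "\<And>k. \<epsilon> k = 1 \<or> \<epsilon> k = - 1"
    have "\<bar>\<epsilon> k * b k\<bar> = \<bar>b k\<bar>" for k using \<epsilon>[of k] by auto
    then show "(\<Sum>i<n. \<bar>\<Sum>k<n. \<epsilon> k * (b k * x i k)\<bar>) \<le> W"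
      using W(2)[of "\<lambda>k. \<epsilon> k * b k"] dual_ball_cong_abs[OF b] by (simp add: mult.assoc)
  qed
  have cols: "(\<Sum>k<n. sqrt ((b k)\<^sup>2 * (c k)\<^sup>2)) \<le> sqrt 3 * W" if b: "b \<in> dual_ball n" for b
  proof -
    have "(\<Sum>k<n. sqrt (\<Sum>i<n. (b k * x i k)\<^sup>2)) \<le> sqrt 3 * W"
    proof (rule sum_row_norms_le)
      fix \<epsilon> :: "nat \<Rightarrow> real" assume \<epsilon>: "\<And>k. \<epsilon> k = 1 \<or> \<epsilon> k = - 1"
      \<comment> \<open>Here the random signs belong to the rows. The signs \<open>s k\<close> of
        the column sums go into \<open>b\<close>, and each \<open>\<epsilon> i\<close> disappears in
        the absolute value of a row sum.\<close>
      define g where "g k = (\<Sum>i<n. \<epsilon> i * (b k * x i k))" for k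
      define s where "s k = (if g k \<ge> 0 then 1 else - 1 :: real)" for k
      have "(\<Sum>k<n. \<bar>g k\<bar>) = (\<Sum>k<n. s k * g k)" by (rule sum.cong) (auto simp: s_def)
      also have "\<dots> = (\<Sum>i<n. \<epsilon> i * (\<Sum>k<n. (s k * b k) * x i k))"
        unfolding g_def sum_distrib_left by (subst sum.swap) (simp add: mult_ac)
      also have "\<dots> \<le> (\<Sum>i<n. \<bar>\<Sum>k<n. (s k * b k) * x i k\<bar>)"
      proof (rule sum_mono)
        show "\<epsilon> i * (\<Sum>k<n. (s k * b k) * x i k) \<le> \<bar>\<Sum>k<n. (s k * b k) * x i k\<bar>" for i
          using \<epsilon>[of i] by auto
      qed
      also have "\<dots> \<le> W"
        by (rule W(2), rule dual_ball_cong_abs[OF b]) (simp add: s_def)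
      finally show "(\<Sum>k<n. \<bar>\<Sum>i<n. \<epsilon> i * (b k * x i k)\<bar>) \<le> W" unfolding g_def .
    qed
    moreover have "(\<Sum>i<n. (b k * x i k)\<^sup>2) = (b k)\<^sup>2 * (c k)\<^sup>2" for k
      by (simp add: c_def sum_nonneg power_mult_distrib sum_distrib_left)
    ultimately show ?thesis by simp
  qed
  \<comment> \<open>Bounds known for squares of dual ball elements extend to the hull
    \<open>D\<close> at the price of a factor \<open>C\<close>, because
    \<open>sqrt (\<beta> k) / C\<close> is again in the dual ball.\<close>
  have scale: "(\<Sum>i<n. sqrt (\<Sum>k<n. \<beta> k * f i k)) \<le> W'"
    if \<beta>: "\<beta> \<in> D" and le: "\<And>b. b \<in> dual_ball n \<Longrightarrow> (\<Sum>i<n. sqrt (\<Sum>k<n. (b k)\<^sup>2 * f i k)) \<le> sqrt 3 * W" for \<beta> f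
  proof -
    have "(\<Sum>k<n. (sqrt (\<beta> k) / C)\<^sup>2 * f i k) = (\<Sum>k<n. \<beta> k * f i k) / C\<^sup>2" for i
      using sqrt_convex_hull_dual_ball(1)[OF \<beta>[unfolded D_def]]
      by (simp add: power_divide sum_divide_distrib)
    then have "(\<Sum>i<n. sqrt (\<Sum>k<n. \<beta> k * f i k)) / C \<le> sqrt 3 * W"
      using le[OF sqrt_convex_hull_dual_ball(2)[OF \<beta>[unfolded D_def]]] C_pos
      by (simp add: real_sqrt_divide flip: sum_divide_distrib)
    then show ?thesis using C_pos by (simp add: W'_def field_simps)
  qed
  have "(\<lambda>_. 0) \<in> dual_ball n"
    using nrm_nonneg[OF truncate_mem] by (simp add: dual_ball_def)
  then have D_ne: "D \<noteq> {}" by (auto simp: D_def)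
  have D_convex: "convex D" by (simp add: D_def)
  have D_nonneg: "0 \<le> \<beta> k" if "\<beta> \<in> D" for \<beta> k
    using sqrt_convex_hull_dual_ball(1) that by (simp add: D_def)
  obtain m where m: "\<And>i. m i > 0" "(\<Sum>i<n. m i) \<le> 2 * W'"
    "\<And>\<beta>. \<beta> \<in> D \<Longrightarrow> (\<Sum>i<n. (\<Sum>k<n. \<beta> k * (x i k)\<^sup>2) / m i) \<le> 2 * W'"
  proof (rule convex_weights[where A = "\<lambda>i \<beta>. \<Sum>k<n. \<beta> k * (x i k)\<^sup>2" and n = n, OF D_convex D_ne])
    show "linear (\<lambda>\<beta>. \<Sum>k<n. \<beta> k * (x i k)\<^sup>2)" for i
      by (rule linearI) (simp_all add: distrib_right sum.distrib sum_distrib_left mult.assoc)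
  qed (use W' scale[OF _ rows] D_nonneg in \<open>auto intro!: sum_nonneg\<close>)
  obtain m' where m': "\<And>k. m' k > 0" "(\<Sum>k<n. m' k) \<le> 2 * W'"
    "\<And>\<beta>. \<beta> \<in> D \<Longrightarrow> (\<Sum>k<n. (\<beta> k * (c k)\<^sup>2) / m' k) \<le> 2 * W'"
  proof (rule convex_weights[where A = "\<lambda>k \<beta>. \<beta> k * (c k)\<^sup>2" and n = n, OF D_convex D_ne])
    show "linear (\<lambda>\<beta>. \<beta> k * (c k)\<^sup>2)" for k
      by (rule linearI) (simp_all add: distrib_right)
    \<comment> \<open>A diagonal \<open>f\<close> leaves one term in each inner sum, so that
      \<open>scale\<close> also covers the column bound.\<close>
    show "(\<Sum>k<n. sqrt (\<beta> k * (c k)\<^sup>2)) \<le> W'" if "\<beta> \<in> D" for \<beta>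
      using scale[OF that, of "\<lambda>i k. if k = i then (c i)\<^sup>2 else 0"] cols
      by (simp add: if_distrib[of "\<lambda>z. _ * z"] cong: if_cong)
  qed (use W' D_nonneg in auto)
  \<comment> \<open>The column sums of \<open>t\<close> are at most 1 because of \<open>m \<le> \<mu>\<close>,
    the row sums because of \<open>c\<^sup>2 / m' \<le> \<nu>\<close>; where \<open>c k = 0\<close>, the quotients are \<open>0\<close>.\<close>
  define \<nu> where "\<nu> k = (\<Sum>i<n. (x i k)\<^sup>2 / m i) + (c k)\<^sup>2 / m' k" for k
  define \<mu> where "\<mu> i = m i + (\<Sum>k<n. (x i k)\<^sup>2 / ((c k)\<^sup>2 / m' k))" for i
  define t where "t i k = (x i k)\<^sup>2 / (\<mu> i * \<nu> k)" for i k
  have \<mu>_pos: "\<mu> i > 0" for i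
    using m(1)[of i] m'(1) unfolding \<mu>_def
    by (intro add_pos_nonneg sum_nonneg) (auto intro!: divide_nonneg_nonneg simp: less_imp_le)
  have \<nu>_ge: "(c k)\<^sup>2 / m' k \<le> \<nu> k" "(\<Sum>i<n. (x i k)\<^sup>2 / m i) \<le> \<nu> k" for k
    using m(1) m'(1) unfolding \<nu>_def by (auto intro!: sum_nonneg divide_nonneg_nonneg simp: less_imp_le)
  have \<nu>_nonneg: "0 \<le> \<nu> k" for k
    using \<nu>_ge(1)[of k] m'(1)[of k] by (smt (verit) divide_nonneg_pos zero_le_power2)
  have c_0: "x i k = 0" if "c k = 0" "i < n" for i k
    using that by (simp add: c_def sum_nonneg_eq_0_iff)
  have c_pos: "(c k)\<^sup>2 / m' k > 0" if "c k \<noteq> 0" for k using that m'(1) by simp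
  have xt: "(x i k)\<^sup>2 = \<mu> i * (t i k * \<nu> k)" if "i < n" for i k
  proof (cases "c k = 0")
    case False
    then have "\<nu> k > 0" using c_pos[of k] \<nu>_ge(1)[of k] by linarith
    then show ?thesis using \<mu>_pos[of i] by (simp add: t_def)
  qed (use c_0 that in \<open>simp add: t_def\<close>)
  have "doubly_substochastic n t"
    unfolding doubly_substochastic_def
  proof (intro conjI allI impI)
    show "0 \<le> t i k" for i k
      using \<mu>_pos[of i] \<nu>_nonneg[of k] by (simp add: t_def)
    show "(\<Sum>k<n. t i k) \<le> 1" if i: "i < n" for i
    proof -
      have "(\<Sum>k<n. t i k) = (\<Sum>k<n. (x i k)\<^sup>2 / \<nu> k) / \<mu> i"
        by (simp add: t_def sum_divide_distrib mult.commute)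
      moreover have "(\<Sum>k<n. (x i k)\<^sup>2 / \<nu> k) \<le> (\<Sum>k<n. (x i k)\<^sup>2 / ((c k)\<^sup>2 / m' k))"
      proof (rule sum_mono)
        show "(x i k)\<^sup>2 / \<nu> k \<le> (x i k)\<^sup>2 / ((c k)\<^sup>2 / m' k)" for k
        proof (cases "c k = 0")
          case False
          then show ?thesis using \<nu>_ge(1)[of k] c_pos[of k] by (intro frac_le) auto
        qed (use c_0 i in simp)
      qed
      moreover have "\<dots> \<le> \<mu> i" using m(1)[of i] by (simp add: \<mu>_def)
      ultimately show ?thesis using \<mu>_pos[of i] by (simp add: pos_divide_le_eq)
    qed
    show "(\<Sum>i<n. t i k) \<le> 1" for k
    proof (cases "\<nu> k = 0")
      case False
      then have pos: "\<nu> k > 0" using \<nu>_nonneg[of k] by simp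
      have "(\<Sum>i<n. t i k) = (\<Sum>i<n. (x i k)\<^sup>2 / \<mu> i) / \<nu> k"
        by (simp add: t_def sum_divide_distrib)
      moreover have "(\<Sum>i<n. (x i k)\<^sup>2 / \<mu> i) \<le> (\<Sum>i<n. (x i k)\<^sup>2 / m i)"
      proof (intro sum_mono divide_left_mono)
        show "m i \<le> \<mu> i" for i
          unfolding \<mu>_def using m'(1) by (auto intro!: sum_nonneg divide_nonneg_nonneg simp: less_imp_le)
      qed (use \<mu>_pos m(1) in auto)
      ultimately show ?thesis using pos \<nu>_ge(2)[of k] by (simp add: pos_divide_le_eq)
    qed (simp add: t_def)
  qed
  note t = this
  have \<nu>_le: "(\<Sum>k<n. \<beta> k * \<nu> k) \<le> 4 * W'" if "\<beta> \<in> D" for \<beta>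
  proof -
    have "(\<Sum>k<n. \<beta> k * (\<Sum>i<n. (x i k)\<^sup>2 / m i)) = (\<Sum>i<n. (\<Sum>k<n. \<beta> k * (x i k)\<^sup>2) / m i)"
      unfolding sum_distrib_left sum_divide_distrib by (subst sum.swap) simp
    then show ?thesis
      using m(3)[OF that] m'(3)[OF that] by (simp add: \<nu>_def distrib_left sum.distrib)
  qed
  have \<mu>_le: "(\<Sum>i<n. \<mu> i) \<le> 4 * W'"
  proof -
    have "(\<Sum>i<n. \<Sum>k<n. (x i k)\<^sup>2 / ((c k)\<^sup>2 / m' k)) = (\<Sum>k<n. (\<Sum>i<n. (x i k)\<^sup>2) / ((c k)\<^sup>2 / m' k))"
      by (subst sum.swap) (simp only: sum_divide_distrib)
    also have "\<dots> = (\<Sum>k<n. (c k)\<^sup>2 / ((c k)\<^sup>2 / m' k))"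
      by (simp add: c_def sum_nonneg)
    \<comment> \<open>Not an equality in general: a column with \<open>c k = 0\<close> contributes
      \<open>0\<close> instead of \<open>m' k\<close>.\<close>
    also have "\<dots> \<le> (\<Sum>k<n. m' k)"
      using m'(1) by (intro sum_mono) (simp add: less_imp_le)
    finally show ?thesis using m(2) m'(2) by (simp add: \<mu>_def sum.distrib)
  qed
  obtain b where b: "b \<in> dual_ball n"
    "(\<Sum>i<n. b i * sqrt (\<Sum>k<n. (x i k)\<^sup>2)) = normE (truncate n (\<lambda>i. sqrt (\<Sum>k<n. (x i k)\<^sup>2)))"
    using dual_ball_norming[of n "\<lambda>i. sqrt (\<Sum>k<n. (x i k)\<^sup>2)"] by blast
  \<comment> \<open>By symmetry the squares of all permutations of \<open>b\<close> lie in
    \<open>D\<close>, where \<open>\<nu>_le\<close> applies; the bilinear estimate carries this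
    bound over to \<open>t\<close>.\<close>
  have bil: "(\<Sum>i<n. (b i)\<^sup>2 * (\<Sum>k<n. t i k * \<nu> k)) \<le> 4 * W'"
  proof (rule doubly_substochastic_bilinear_le[OF t _ \<nu>_nonneg])
    fix p assume "p permutes {..<n}"
    then have "(\<lambda>k. (b (p k))\<^sup>2) \<in> D"
      using dual_ball_permute[OF b(1)] unfolding D_def
      by (intro hull_inc image_eqI[of _ _ "b \<circ> p"]) auto
    then show "(\<Sum>i<n. (b (p i))\<^sup>2 * \<nu> i) \<le> 4 * W'" by (rule \<nu>_le)
  qed simp
  have "(\<Sum>i<n. b i * sqrt (\<Sum>k<n. (x i k)\<^sup>2))
      = (\<Sum>i<n. sqrt (\<mu> i) * (b i * sqrt (\<Sum>k<n. t i k * \<nu> k)))"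
    using xt by (intro sum.cong) (auto simp: real_sqrt_mult simp flip: sum_distrib_left)
  also have "\<dots> \<le> sqrt (\<Sum>i<n. (sqrt (\<mu> i))\<^sup>2) * sqrt (\<Sum>i<n. (b i * sqrt (\<Sum>k<n. t i k * \<nu> k))\<^sup>2)"
    unfolding real_sqrt_mult[symmetric] by (intro real_le_rsqrt Cauchy_Schwarz_ineq_sum)
  also have "(\<Sum>i<n. (sqrt (\<mu> i))\<^sup>2) = (\<Sum>i<n. \<mu> i)" using \<mu>_pos by (simp add: less_imp_le)
  also have "(\<Sum>i<n. (b i * sqrt (\<Sum>k<n. t i k * \<nu> k))\<^sup>2) = (\<Sum>i<n. (b i)\<^sup>2 * (\<Sum>k<n. t i k * \<nu> k))"
  proof (rule sum.cong)
    fix i assume "i \<in> {..<n}"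
    then have "0 \<le> (\<Sum>k<n. t i k * \<nu> k)"
      using t \<nu>_nonneg by (intro sum_nonneg mult_nonneg_nonneg) (auto simp: doubly_substochastic_def)
    then show "(b i * sqrt (\<Sum>k<n. t i k * \<nu> k))\<^sup>2 = (b i)\<^sup>2 * (\<Sum>k<n. t i k * \<nu> k)"
      by (simp add: power_mult_distrib)
  qed simp
  also have "sqrt (\<Sum>i<n. \<mu> i) * sqrt (\<Sum>i<n. (b i)\<^sup>2 * (\<Sum>k<n. t i k * \<nu> k)) \<le> sqrt (4 * W') * sqrt (4 * W')"
  proof (rule mult_mono)
    show "sqrt (\<Sum>i<n. \<mu> i) \<le> sqrt (4 * W')" using \<mu>_le by (rule real_sqrt_le_mono)
    show "sqrt (\<Sum>i<n. (b i)\<^sup>2 * (\<Sum>k<n. t i k * \<nu> k)) \<le> sqrt (4 * W')" using bil by (rule real_sqrt_le_mono)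
    show "0 \<le> sqrt (\<Sum>i<n. (b i)\<^sup>2 * (\<Sum>k<n. t i k * \<nu> k))"
      using t \<nu>_nonneg
      by (intro real_sqrt_ge_zero sum_nonneg mult_nonneg_nonneg) (auto simp: doubly_substochastic_def)
  qed (use W' in simp)
  also have "\<dots> = 4 * sqrt 3 * C * W" using W' by (simp add: W'_def)
  finally show ?thesis unfolding b(2) .
qed

section \<open>From finite matrices to sequences in \<open>E\<close>\<close>

lemma normE_truncate_le_sum: "normE (truncate n y) \<le> (\<Sum>k<n. \<bar>y k\<bar>)"
proof -
  have "normE (truncate n y) \<le> (\<Sum>k<n. normE (y k *\<^sub>R unit_vec k))"
    unfolding truncate_eq_sum by (intro nrm_sum_le scaleR_mem unit_vec_mem)
  then show ?thesis unfolding norm_scaleR[OF unit_vec_mem] normE_unit_vec by simp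
qed

text \<open>If the truncations were not Cauchy, \<open>z\<close> would have infinitely many disjoint
  blocks of norm at least \<open>e\<close>; by 2-concavity \<open>J\<close> of them force
  \<open>J * e^2 \<le> (C * M)^2\<close>, which fails for large \<open>J\<close>. The limit is
  \<open>z\<close> because coordinates are continuous.\<close>

lemma bounded_truncations_imp_mem:
  assumes M: "\<And>n. normE (truncate n z) \<le> M"
  shows "z \<in> E" and "normE z \<le> M"
proof -
  define s where "s n = truncate n z" for n
  have sE: "s n \<in> E" for n unfolding s_def by (rule truncate_mem)
  have tail: "\<exists>N. \<forall>m\<ge>N. normE (s m - s N) < e" if e: "e > 0" for e
  proof (rule ccontr)
    assume "\<not> ?thesis"
    then have "\<forall>N. \<exists>m\<ge>N. e \<le> normE (s m - s N)" by (meson not_le)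
    then obtain g where g: "\<And>N. N \<le> g N" "\<And>N. e \<le> normE (s (g N) - s N)" by metis
    define q where "q j = (g ^^ j) 0" for j
    have q: "q 0 = 0" "q (Suc j) = g (q j)" for j by (auto simp: q_def)
    define u where "u j = s (q (Suc j)) - s (q j)" for j
    have uE: "u j \<in> E" for j unfolding u_def by (intro diff_mem sE)
    \<comment> \<open>The \<open>u j\<close> are disjoint blocks of \<open>z\<close>.\<close>
    have sq: "(\<Sum>j<J. (u j k)\<^sup>2) = (s (q J) k)\<^sup>2" for J k
    proof (induction J)
      case (Suc J)
      have "(u J k)\<^sup>2 + (s (q J) k)\<^sup>2 = (s (q (Suc J)) k)\<^sup>2"
        using g(1)[of "q J"] by (auto simp: u_def s_def q(2))
      then show ?case using Suc by simp
    qed (simp add: s_def q)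
    have bound: "real J * e\<^sup>2 \<le> (C * M)\<^sup>2" for J
    proof -
      have "real J * e\<^sup>2 = (\<Sum>j<J. e\<^sup>2)" by simp
      also have "\<dots> \<le> (\<Sum>j<J. (normE (u j))\<^sup>2)"
        using g(2) e by (intro sum_mono power_mono) (auto simp: u_def q(2))
      finally have "sqrt (real J * e\<^sup>2) \<le> sqrt (\<Sum>j<J. (normE (u j))\<^sup>2)" by (rule real_sqrt_le_mono)
      also have "\<dots> \<le> C * normE (\<lambda>k. sqrt (\<Sum>j<J. (u j k)\<^sup>2))"
        using uE by (intro two_concave_set) auto
      also have "\<dots> \<le> C * M"
      proof (rule mult_left_mono)
        have "normE (\<lambda>k. sqrt (\<Sum>j<J. (u j k)\<^sup>2)) \<le> normE (s (q J))"
          using solid[OF sE, of "\<lambda>k. sqrt (\<Sum>j<J. (u j k)\<^sup>2)" "q J"] by (simp add: sq)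
        then show "normE (\<lambda>k. sqrt (\<Sum>j<J. (u j k)\<^sup>2)) \<le> M" using M[of "q J"] by (simp add: s_def)
      qed (use C_pos in simp)
      finally show ?thesis by (rule sqrt_le_D)
    qed
    obtain J where "(C * M)\<^sup>2 / e\<^sup>2 < real J" using reals_Archimedean2 by blast
    then have "(C * M)\<^sup>2 < real J * e\<^sup>2" using e by (simp add: field_simps)
    then show False using bound[of J] by simp
  qed
  have cauchy: "\<exists>N. \<forall>m\<ge>N. \<forall>n\<ge>N. normE (s m - s n) < e" if e: "e > 0" for e
  proof -
    obtain N where N: "\<And>m. m \<ge> N \<Longrightarrow> normE (s m - s N) < e / 2" using tail[of "e / 2"] e by auto
    have "normE (s m - s n) < e" if "m \<ge> N" "n \<ge> N" for m n
      using N[OF that(1)] N[OF that(2)] nrm_triangle_diff[OF sE sE sE, of m n N]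
        nrm_diff_commute[OF sE sE, of N n] by simp
    then show ?thesis by blast
  qed
  obtain l where l: "l \<in> E" "(\<lambda>n. normE (s n - l)) \<longlonglongrightarrow> 0"
    using complete_X[OF sE cauchy] by blast
  have "l k = z k" for k
  proof (rule LIMSEQ_unique)
    have "(\<lambda>n. s n k - l k) \<longlonglongrightarrow> 0"
    proof (rule tendsto_rabs_zero_cancel, rule tendsto_sandwich[OF _ _ tendsto_const l(2)])
      show "\<forall>\<^sub>F n in sequentially. \<bar>s n k - l k\<bar> \<le> normE (s n - l)"
        using abs_le_normE[OF diff_mem[OF sE l(1)], of _ k] by (intro always_eventually) simp
    qed simp
    then show "(\<lambda>n. s n k) \<longlonglongrightarrow> l k" by (simp add: LIM_zero_iff)
    have "\<forall>\<^sub>F n in sequentially. z k = s n k"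
      using eventually_gt_at_top[of k] by eventually_elim (simp add: s_def)
    then show "(\<lambda>n. s n k) \<longlonglongrightarrow> z k" by (rule tendsto_eventually[OF eventually_mono]) simp
  qed
  then have "l = z" by auto
  then show "z \<in> E" using l(1) by simp
  have "normE l \<le> normE (s n - l) + M" for n
    using nrm_triangle_diff[OF l(1) sE zero_mem, of n] nrm_diff_commute[OF l(1) sE, of n] M[of n]
    by (simp add: s_def)
  moreover have "(\<lambda>n. normE (s n - l) + M) \<longlonglongrightarrow> 0 + M" by (intro tendsto_intros l(2))
  ultimately have "normE l \<le> 0 + M" by (intro LIMSEQ_le_const) auto
  then show "normE z \<le> M" using \<open>l = z\<close> by simp
qed

lemma summable_squares:
  assumes "x \<in> E"
  shows "summable (\<lambda>k. (x k)\<^sup>2)"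
proof (rule summableI_nonneg_bounded)
  show "(\<Sum>k<n. (x k)\<^sup>2) \<le> (C * normE x)\<^sup>2" for n
    using l2_partial_sum_le[OF assms] by (rule sqrt_le_D)
qed simp

lemma lp_norm_2:
  assumes "x \<in> E"
  shows "lp_norm 2 x = sqrt (\<Sum>k. (x k)\<^sup>2)"
  using suminf_nonneg[OF summable_squares[OF assms]] by (simp add: lp_norm_def powr_half_sqrt)

lemma lp_norm_2_le:
  assumes "x \<in> E"
  shows "lp_norm 2 x \<le> C * normE x"
proof -
  have "0 \<le> C * normE x" using C_pos nrm_nonneg[OF assms] by simp
  moreover have "(\<Sum>k. (x k)\<^sup>2) \<le> (C * normE x)\<^sup>2"
    using sqrt_le_D[OF l2_partial_sum_le[OF assms]] by (intro suminf_le_const summable_squares assms)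
  ultimately show ?thesis unfolding lp_norm_2[OF assms] by (rule real_le_lsqrt)
qed

lemma E_subset_l2: "E \<subseteq> lp_space 2"
  using summable_squares by (auto simp: lp_space_def)

text \<open>Cutting off the columns at \<open>N\<close> leaves a finite matrix. Its row norms tend
  to the full norms, and the triangle inequality bounds the error by the sum over the
  \<open>n\<close> rows.\<close>

lemma l2_norms_le:
  assumes x: "\<And>i. i < n \<Longrightarrow> x i \<in> E" and W: "W > 0"
    and dual: "\<And>N b. b \<in> dual_ball N \<Longrightarrow> (\<Sum>i<n. \<bar>\<Sum>k<N. b k * x i k\<bar>) \<le> W"
  shows "normE (truncate n (\<lambda>i. lp_norm 2 (x i))) \<le> 4 * sqrt 3 * C * W"
proof (rule LIMSEQ_le_const)
  define r where "r N i = sqrt (\<Sum>k<N. (x i k)\<^sup>2)" for N i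
  have "(\<lambda>N. r N i) \<longlonglongrightarrow> lp_norm 2 (x i)" if "i < n" for i
    unfolding r_def lp_norm_2[OF x[OF that]]
    by (intro tendsto_real_sqrt summable_LIMSEQ summable_squares x that)
  then have "(\<lambda>N. 4 * sqrt 3 * C * W + (\<Sum>i<n. \<bar>lp_norm 2 (x i) - r N i\<bar>))
      \<longlonglongrightarrow> 4 * sqrt 3 * C * W + (\<Sum>i<n. \<bar>lp_norm 2 (x i) - lp_norm 2 (x i)\<bar>)"
    by (intro tendsto_intros) auto
  then show "(\<lambda>N. 4 * sqrt 3 * C * W + (\<Sum>i<n. \<bar>lp_norm 2 (x i) - r N i\<bar>))
      \<longlonglongrightarrow> 4 * sqrt 3 * C * W" by simp
  have "normE (truncate n (\<lambda>i. lp_norm 2 (x i)))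
      \<le> 4 * sqrt 3 * C * W + (\<Sum>i<n. \<bar>lp_norm 2 (x i) - r N i\<bar>)" if N: "n \<le> N" for N
  proof -
    \<comment> \<open>Rows of zeros make the matrix square, which requires
      \<open>n \<le> N\<close>.\<close>
    define y where "y i = (if i < n then x i else 0)" for i
    have "normE (truncate N (\<lambda>i. sqrt (\<Sum>k<N. (y i k)\<^sup>2))) \<le> 4 * sqrt 3 * C * W"
    proof (rule matrix_row_norms_le[OF W])
      fix b assume "b \<in> dual_ball N"
      have "(\<Sum>i<N. \<bar>\<Sum>k<N. b k * y i k\<bar>) = (\<Sum>i<n. \<bar>\<Sum>k<N. b k * x i k\<bar>)"
        using N by (intro sum.mono_neutral_cong_right) (auto simp: y_def)
      then show "(\<Sum>i<N. \<bar>\<Sum>k<N. b k * y i k\<bar>) \<le> W" using dual[OF \<open>b \<in> dual_ball N\<close>] by simp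
    qed
    moreover have "truncate N (\<lambda>i. sqrt (\<Sum>k<N. (y i k)\<^sup>2)) = truncate n (r N)"
      using N by (auto simp: fun_eq_iff y_def r_def)
    moreover have "truncate n (\<lambda>i. lp_norm 2 (x i))
        = truncate n (r N) + truncate n (\<lambda>i. lp_norm 2 (x i) - r N i)"
      by (auto simp: fun_eq_iff)
    ultimately show ?thesis
      using norm_triangle[OF truncate_mem truncate_mem, of n "r N" n "\<lambda>i. lp_norm 2 (x i) - r N i"]
        normE_truncate_le_sum[of n "\<lambda>i. lp_norm 2 (x i) - r N i"] by simp
  qed
  then show "\<exists>N0. \<forall>N\<ge>N0. normE (truncate n (\<lambda>i. lp_norm 2 (x i)))
      \<le> 4 * sqrt 3 * C * W + (\<Sum>i<n. \<bar>lp_norm 2 (x i) - r N i\<bar>)" by blast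
qed

lemma dual_ball_functional_le:
  assumes "b \<in> dual_ball N" "y \<in> E"
  shows "\<bar>\<Sum>k<N. b k * y k\<bar> \<le> normE y"
  using sum_abs[of "\<lambda>k. b k * y k" "{..<N}"] dual_ballD[OF assms(1), of y] normE_truncate_le[OF assms(2), of N]
  by linarith

lemma unconditionally_summable_l2_norms_mem:
  assumes x: "unconditionally_summable E normE x"
  shows "(\<lambda>n. lp_norm 2 (x n)) \<in> E"
proof -
  have xE: "x i \<in> E" for i using x by (simp add: unconditionally_summable_def)
  obtain K where K: "\<And>F. finite F \<Longrightarrow> normE (\<Sum>i\<in>F. x i) \<le> K"
    using unconditionally_summable_bounded[OF x] by blast
  have K0: "K \<ge> 0" using K[of "{}"] nrm_0 by simp
  show ?thesis
  proof (rule bounded_truncations_imp_mem(1), rule l2_norms_le)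
    \<comment> \<open>The indices with \<open>g i < 0\<close> and the others each contribute at most
      \<open>K\<close>; the summand \<open>1\<close> makes the bound positive even if
      \<open>K = 0\<close>.\<close>
    show "2 * K + 1 > 0" using K0 by simp
    fix n N b assume b: "b \<in> dual_ball N"
    define g where "g i = (\<Sum>k<N. b k * x i k)" for i
    have F: "\<bar>\<Sum>i\<in>F. g i\<bar> \<le> K" if "finite F" for F
    proof -
      have "(\<Sum>i\<in>F. g i) = (\<Sum>k<N. b k * (\<Sum>i\<in>F. x i) k)"
        unfolding g_def sum_fun_apply sum_distrib_left by (rule sum.swap)
      then show ?thesis
        using dual_ball_functional_le[OF b sum_mem[of F x]] xE K[OF that] by (metis order_trans)
    qed
    have "(\<Sum>i<n. \<bar>g i\<bar>) = (\<Sum>i\<in>{..<n} \<inter> - {i. g i < 0}. g i) - (\<Sum>i\<in>{..<n} \<inter> {i. g i < 0}. g i)"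
      by (simp add: abs_if sum.If_cases sum_negf)
    then show "(\<Sum>i<n. \<bar>\<Sum>k<N. b k * x i k\<bar>) \<le> 2 * K + 1"
      using F[of "{..<n} \<inter> - {i. g i < 0}"] F[of "{..<n} \<inter> {i. g i < 0}"] by (simp add: g_def)
  qed (rule xE)
qed

section \<open>Functionals on \<open>E\<close> and the summing property\<close>

lemma l1_embedded: "continuously_embedded (lp_space 1) (lp_norm 1) E normE"
  and l1_norm_ge: "x \<in> lp_space 1 \<Longrightarrow> normE x \<le> lp_norm 1 x"
proof -
  have *: "x \<in> E \<and> normE x \<le> lp_norm 1 x" if "x \<in> lp_space 1" for x
  proof -
    have summ: "summable (\<lambda>n. \<bar>x n\<bar>)" using that by (simp add: lp_space_def)
    have "normE (truncate n x) \<le> (\<Sum>k. \<bar>x k\<bar>)" for n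
      using normE_truncate_le_sum[of n x] sum_le_suminf[OF summ, of "{..<n}"] by simp
    from bounded_truncations_imp_mem[of x, OF this] show ?thesis
      using suminf_nonneg[OF summ] by (simp add: lp_norm_def)
  qed
  then show "x \<in> lp_space 1 \<Longrightarrow> normE x \<le> lp_norm 1 x" by blast
  show "continuously_embedded (lp_space 1) (lp_norm 1) E normE"
    using * unfolding continuously_embedded_def bounded_linear_on_def
    by (auto intro!: exI[of _ 1])
qed

text \<open>The summing estimate is first obtained without the embedding norm; this lower bound
  allows the factor to be inserted.\<close>

lemma one_le_onorm_l1: "1 \<le> onorm_on (lp_space 1) (lp_norm 1) normE id"
proof -
  have e0: "(\<lambda>n. \<bar>unit_vec 0 n\<bar>) sums (1 :: real)"
    using sums_single[of 0 "\<lambda>_. 1 :: real"] by (simp add: unit_vec_def if_distrib cong: if_cong)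
  have "normE (id (unit_vec 0)) \<le> onorm_on (lp_space 1) (lp_norm 1) normE id"
    unfolding onorm_on_def
  proof (rule cSUP_upper)
    show "unit_vec 0 \<in> {x \<in> lp_space 1. lp_norm 1 x \<le> 1}"
      using e0 by (auto simp: lp_space_def lp_norm_def sums_iff)
    show "bdd_above ((\<lambda>x. normE (id x)) ` {x \<in> lp_space 1. lp_norm 1 x \<le> 1})"
      using l1_norm_ge by (intro bdd_aboveI2[of _ _ 1]) fastforce
  qed
  then show ?thesis by (simp add: normE_unit_vec)
qed

lemma dual_unit_ball_le:
  assumes f: "f \<in> dual_unit_ball E normE" and y: "y \<in> E"
  shows "\<bar>f y\<bar> \<le> normE y"
proof (cases "normE y = 0")
  case True
  then have "y = 0" using norm_eq_0 y by blast
  have "f (0 *\<^sub>R y) = 0 *\<^sub>R f y"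
    using f y unfolding dual_unit_ball_def bounded_linear_on_def by blast
  then show ?thesis using True \<open>y = 0\<close> by simp
next
  case False
  then have pos: "normE y > 0" using nrm_nonneg[OF y] by simp
  obtain K where K: "\<And>y. y \<in> E \<Longrightarrow> \<bar>f y\<bar> \<le> K * normE y"
    using f unfolding dual_unit_ball_def bounded_linear_on_def by blast
  have scale: "f ((1 / normE y) *\<^sub>R y) = (1 / normE y) *\<^sub>R f y"
    using f y unfolding dual_unit_ball_def bounded_linear_on_def by blast
  have "\<bar>f ((1 / normE y) *\<^sub>R y)\<bar> \<le> onorm_on E normE abs f"
    unfolding onorm_on_def
  proof (rule cSUP_upper)
    show "(1 / normE y) *\<^sub>R y \<in> {x \<in> E. normE x \<le> 1}"
      using pos scaleR_mem[OF y, of "1 / normE y"] norm_scaleR[OF y, of "1 / normE y"] by simp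
    \<comment> \<open>The supremum in \<open>onorm_on\<close> is a real one, so it is an upper bound
      only because \<open>f\<close> is bounded on the unit ball.\<close>
    show "bdd_above ((\<lambda>x. \<bar>f x\<bar>) ` {x \<in> E. normE x \<le> 1})"
    proof (rule bdd_aboveI2)
      fix x assume "x \<in> {x \<in> E. normE x \<le> 1}"
      then have x: "x \<in> E" "normE x \<le> 1" by auto
      have "K * normE x \<le> \<bar>K\<bar> * 1" using x nrm_nonneg[OF x(1)] by (intro mult_mono) auto
      then show "\<bar>f x\<bar> \<le> \<bar>K\<bar>" using K[OF x(1)] by simp
    qed
  qed
  also have "\<dots> \<le> 1" using f by (simp add: dual_unit_ball_def)
  finally show ?thesis using pos unfolding scale by (simp add: abs_mult field_simps)
qed

text \<open>This connects the coordinate description \<open>dual_ball\<close> with the abstract dual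
  unit ball in the definition of summing operators.\<close>

lemma dual_ball_functional_mem:
  assumes b: "b \<in> dual_ball N"
  shows "(\<lambda>y. \<Sum>k<N. b k * y k) \<in> dual_unit_ball E normE"
proof -
  note le = dual_ball_functional_le[OF b]
  have "onorm_on E normE abs (\<lambda>y. \<Sum>k<N. b k * y k) \<le> 1"
    unfolding onorm_on_def
  proof (rule cSUP_least)
    show "{x \<in> E. normE x \<le> 1} \<noteq> {}" using zero_mem nrm_0 by auto
    show "\<bar>\<Sum>k<N. b k * y k\<bar> \<le> 1" if "y \<in> {x \<in> E. normE x \<le> 1}" for y
      using le[of y] that by auto
  qed
  moreover have "\<exists>K. \<forall>y\<in>E. \<bar>\<Sum>k<N. b k * y k\<bar> \<le> K * normE y" using le by (intro exI[of _ 1]) simp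
  ultimately show ?thesis
    by (simp add: dual_unit_ball_def bounded_linear_on_def distrib_left sum.distrib sum_distrib_left mult_ac)
qed

lemma identity_summing: "summing_operator E normE 1 E normE (lp_space 2) (lp_norm 2) id"
  unfolding summing_operator_def
proof (intro conjI)
  show "continuously_embedded (lp_space 1) (lp_norm 1) E normE" by (rule l1_embedded)
  show "bounded_linear_on E normE (lp_space 2) (lp_norm 2) id"
    using E_subset_l2 lp_norm_2_le unfolding bounded_linear_on_def by (auto intro!: exI[of _ C])
  define K where "K = 4 * sqrt 3 * C"
  have K: "K > 0" using C_pos by (simp add: K_def)
  have "normE (\<Sum>i<n. lp_norm 2 (id (x i)) *\<^sub>R unit_vec i)
      \<le> K * onorm_on (lp_space 1) (lp_norm 1) normE id *
         (SUP f\<in>dual_unit_ball E normE. (\<Sum>i<n. \<bar>f (x i)\<bar> powr 1) powr (1 / 1))"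
    if x: "\<forall>i<n. x i \<in> E" for n x
  proof -
    have simps: "(\<Sum>i<n. \<bar>f (x i)\<bar> powr 1) powr (1 / 1) = (\<Sum>i<n. \<bar>f (x i)\<bar>)" for f :: "(nat \<Rightarrow> real) \<Rightarrow> real"
      by (simp add: sum_nonneg)
    define w where "w = (SUP f\<in>dual_unit_ball E normE. (\<Sum>i<n. \<bar>f (x i)\<bar>))"
    have bdd: "bdd_above ((\<lambda>f. \<Sum>i<n. \<bar>f (x i)\<bar>) ` dual_unit_ball E normE)"
      using x dual_unit_ball_le by (intro bdd_aboveI2[of _ _ "\<Sum>i<n. normE (x i)"] sum_mono) auto
    \<comment> \<open>Functionals with finitely many coordinates suffice, so the full dual of
      \<open>E\<close> need not be described.\<close>
    have w_ge: "(\<Sum>i<n. \<bar>\<Sum>k<N. b k * x i k\<bar>) \<le> w" if "b \<in> dual_ball N" for N b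
      unfolding w_def using dual_ball_functional_mem[OF that] bdd by (rule cSUP_upper)
    have "(\<lambda>_. 0) \<in> dual_ball 0" using nrm_nonneg[OF truncate_mem] by (simp add: dual_ball_def)
    from w_ge[OF this] have w: "w \<ge> 0" by simp
    have "normE (truncate n (\<lambda>i. lp_norm 2 (x i))) \<le> K * w"
    \<comment> \<open>The matrix estimate asks for a positive bound, whereas \<open>w\<close> may be
      \<open>0\<close>; hence \<open>w + e / K\<close>, which costs exactly
      \<open>e\<close>.\<close>
    proof (rule field_le_epsilon)
      fix e :: real assume e: "e > 0"
      have "normE (truncate n (\<lambda>i. lp_norm 2 (x i))) \<le> 4 * sqrt 3 * C * (w + e / K)"
      proof (rule l2_norms_le)
        show "w + e / K > 0" using w e K by (simp add: add_nonneg_pos)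
        then show "(\<Sum>i<n. \<bar>\<Sum>k<N. b k * x i k\<bar>) \<le> w + e / K" if "b \<in> dual_ball N" for N b
          using w_ge[OF that] e K by (smt (verit) divide_pos_pos)
      qed (use x in auto)
      also have "\<dots> = K * w + e" unfolding K_def[symmetric] using K by (simp add: distrib_left)
      finally show "normE (truncate n (\<lambda>i. lp_norm 2 (x i))) \<le> K * w + e" .
    qed
    also have "\<dots> \<le> K * onorm_on (lp_space 1) (lp_norm 1) normE id * w"
      using one_le_onorm_l1 w K by (intro mult_right_mono) auto
    finally show ?thesis unfolding simps w_def[symmetric] truncate_eq_sum id_apply .
  qed
  then show "\<exists>K>0. \<forall>n. \<forall>x :: nat \<Rightarrow> nat \<Rightarrow> real. (\<forall>i<n. x i \<in> E) \<longrightarrow>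
      normE (\<Sum>i<n. lp_norm 2 (id (x i)) *\<^sub>R unit_vec i)
        \<le> K * onorm_on (lp_space 1) (lp_norm 1) normE id *
           (SUP f\<in>dual_unit_ball E normE. (\<Sum>i<n. \<bar>f (x i)\<bar> powr 1) powr (1 / 1))"
    using K by blast
qed

end

theorem theorem4p1:
  fixes E :: "(nat \<Rightarrow> real) set" and normE :: "(nat \<Rightarrow> real) \<Rightarrow> real"
  assumes "banach_sequence_space E normE"
    and "symmetric_space E normE"
    and "two_concave E normE"
    and "\<And>n. normE (unit_vec n) = 1"
  shows "summing_operator E normE 1 E normE (lp_space 2) (lp_norm 2) id \<and>
         (\<forall>x :: nat \<Rightarrow> nat \<Rightarrow> real. unconditionally_summable E normE x \<longrightarrow>
            (\<lambda>n. lp_norm 2 (x n)) \<in> E)"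
proof -
  obtain C where C: "C > 0" "\<forall>n. \<forall>x :: nat \<Rightarrow> nat \<Rightarrow> real. (\<forall>i<n. x i \<in> E) \<longrightarrow>
      sqrt (\<Sum>i<n. (normE (x i))\<^sup>2) \<le> C * normE (\<lambda>k. sqrt (\<Sum>i<n. \<bar>x i k\<bar>\<^sup>2))"
    using assms(3) unfolding two_concave_def by blast
  interpret two_concave_symmetric_space E normE C
    by (rule two_concave_symmetric_space.intro[OF assms(1)], unfold_locales)
      (use assms(2,4) C in auto)
  show ?thesis using identity_summing unconditionally_summable_l2_norms_mem by blast
qed

end
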